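(* Let $P=P(\sigma)$ be the interval poset of a permutation $\sigma$. Then $P$ has exactly two generators if and only if $\sigma^{-1}$ is a separable permutation of size at least $2$, or $\sigma^{-1}=2413$ or $3142$ (equivalently, if and only if $\sigma$ is a separable permutation of size at least $2$, or $\sigma=2413$ or $3142$). As a consequence, the number $a_n$ of interval posets with $n$ minimal elements having exactly two generators is given by $a_1=0$, $a_2=s_2=1$, $a_3=s_3=3$, $a_4=s_4+1=12$ and $a_n=s_n$ for all $n\ge5$, where $s_n$ is the $n$-th little Schröder number.
   Context: A permutation $\sigma=\sigma(1)\dots\sigma(n)$ of size $n$ is a word on $\{1,\dots,n\}$ containing each letter exactly once. A non-empty interval of $\sigma$ is a set of values $[j,j+h]=\{j,\dots,j+h\}$ such that $\{\sigma(i),\dots,\sigma(i+h)\}=[j,j+h]$ for some $i$. $P(\sigma)$ is the poset of all non-empty intervals of $\sigma$ (including singletons and $[1,n]$) ordered by inclusion. An interval poset is a poset of the form $P(\sigma)$; equality of interval posets means equality as sets of intervals ordered by inclusion (not merely isomorphism). A generator of an interval poset $P$ is a permutation $\tau$ such that $P(\tau)=P$. The minimal elements of $P(\sigma)$ are the singletons, so $P(\sigma)$ has $n$ minimal elements when $\sigma$ has size $n$. A permutation is separable if it avoids the patterns $2413$ and $3142$, i.e. has no subsequence order-isomorphic to $2413$ or $3142$. The little Schröder numbers (OEIS A001003) are indexed so that $s_1=1,\ s_2=1,\ s_3=3,\ s_4=11,\ s_5=45,\dots$; that is, $s_n$ is the number of rooted plane trees with $n$ leaves in which every internal node has at least two children.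 *)

theory Defs
  imports "HOL-Library.Sublist" "HOL-Combinatorics.Multiset_Permutations"
begin

definition perm_word :: "nat list \<Rightarrow> bool" where
  "perm_word \<sigma> \<longleftrightarrow> \<sigma> \<in> permutations_of_set {1..length \<sigma>}"

text \<open>Positions in a word are counted from 1, as usual for permutations, whereas
  list indexing starts at 0.\<close>

definition letter :: "nat list \<Rightarrow> nat \<Rightarrow> nat" where
  "letter \<sigma> i = \<sigma> ! (i - 1)"

definition inverse_word :: "nat list \<Rightarrow> nat list" where
  "inverse_word \<sigma> =
     map (inv_into {1..length \<sigma>} (letter \<sigma>)) [1..<Suc (length \<sigma>)]"

text \<open>Intervals are sets of values, not of positions. The poset is represented by its
  underlying set; the order is always inclusion of sets, so equality of posets is
  equality of these sets.\<close>

definition interval_poset :: "nat list \<Rightarrow> nat set set" where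
  "interval_poset \<sigma> =
     {{j..j + h} | i j h. 1 \<le> i \<and> i + h \<le> length \<sigma> \<and> letter \<sigma> ` {i..i + h} = {j..j + h}}"

definition is_interval_poset :: "nat set set \<Rightarrow> bool" where
  "is_interval_poset Q \<longleftrightarrow> (\<exists>\<sigma>. perm_word \<sigma> \<and> Q = interval_poset \<sigma>)"

definition generators :: "nat set set \<Rightarrow> nat list set" where
  "generators Q = {\<tau>. perm_word \<tau> \<and> interval_poset \<tau> = Q}"

definition minimal_elements :: "nat set set \<Rightarrow> nat set set" where
  "minimal_elements Q = {I \<in> Q. \<not> (\<exists>J \<in> Q. J \<subset> I)}"

definition order_isomorphic :: "nat list \<Rightarrow> nat list \<Rightarrow> bool" where
  "order_isomorphic xs ys \<longleftrightarrow> length xs = length ys \<and>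
     (\<forall>i < length xs. \<forall>j < length xs. xs ! i < xs ! j \<longleftrightarrow> ys ! i < ys ! j)"

definition contains_pattern :: "nat list \<Rightarrow> nat list \<Rightarrow> bool" where
  "contains_pattern \<sigma> p \<longleftrightarrow> (\<exists>xs. subseq xs \<sigma> \<and> order_isomorphic xs p)"

definition separable :: "nat list \<Rightarrow> bool" where
  "separable \<sigma> \<longleftrightarrow> perm_word \<sigma> \<and>
     \<not> contains_pattern \<sigma> [2, 4, 1, 3] \<and> \<not> contains_pattern \<sigma> [3, 1, 4, 2]"

definition num_two_generator_posets :: "nat \<Rightarrow> nat" where
  "num_two_generator_posets n =
     card {Q. is_interval_poset Q \<and> card (minimal_elements Q) = n \<and> card (generators Q) = 2}"

datatype plane_tree = Leaf | Node "plane_tree list"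

primrec leaves :: "plane_tree \<Rightarrow> nat" where
  "leaves Leaf = 1"
| "leaves (Node ts) = sum_list (map leaves ts)"

fun schroeder_tree :: "plane_tree \<Rightarrow> bool" where
  "schroeder_tree Leaf \<longleftrightarrow> True"
| "schroeder_tree (Node ts) \<longleftrightarrow> 2 \<le> length ts \<and> (\<forall>t \<in> set ts. schroeder_tree t)"

text \<open>The little Schroeder numbers, with the indexing in which the values at
  1, 2, 3, 4, 5 are 1, 1, 3, 11, 45.\<close>

definition little_schroeder :: "nat \<Rightarrow> nat" where
  "little_schroeder n = card {t. schroeder_tree t \<and> leaves t = n}"

end

theory Submission
  imports Defs
begin

text \<open>
Read a permutation through its position map \<open>f\<close>, which sends a value to the place where it
stands. A set of consecutive values is an interval of the permutation exactly when it is a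
\<^emph>\<open>block\<close> of \<open>f\<close>: no other value stands between two of its members. So the interval poset
depends only on the order that \<open>f\<close> induces on the values, and it does not change when this order
is reversed, that is, when the word is read backwards. Generators of a poset on at least two
values therefore come in pairs, and the question is when a single pair is all there is.

Let the order avoid both patterns. Then the values split into a lower and an upper part
such that one part stands entirely before the other (\<open>avoids_imp_split\<close>); the same holds
inside every block. The order is thus described by the directions of nested splits. The blocks
show whether the directions of two nested splits agree (\<open>block_tail_iff\<close>), so a single bit, the
direction of the outermost split, is left open, and there are exactly two generators
(\<open>avoids_imp_unique_up_to_reversal\<close>).

Let the order contain a pattern. Then some block of at least two values is not the union of two
smaller blocks (\<open>all_split_imp_avoids\<close>). If it is proper, then no other block overlaps it
(\<open>overlap_imp_splits\<close>), and reversing the order inside it changes no block. If only the set of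
all values is unsplittable, a maximal proper block of at least two values can be reversed
instead. If there is no such block either, the permutation is simple, and all simple
permutations of one size have the same poset; from size 5 on there are at least two pairs of
them (\<open>ex_two_simple\<close>). In all three cases a third generator exists
(\<open>not_avoids_imp_other_order\<close>). Below size 5, a permutation that contains a pattern is one of the
two patterns, and these are reversals of each other.

For the count, give the nodes of a plane tree alternating directions. A tree, together with the
direction of its root, prescribes an order on its leaves; orders obtained in this way are those
that avoid the patterns, and the tree can be read off from the order
(\<open>realizes_tree_unique\<close>, \<open>avoids_imp_realizes\<close>). The direction of the root is exactly the bit that
the poset forgets. Hence the posets of separable permutations correspond to Schroeder trees
(\<open>card_separable_interval_sets\<close>), and size 4 contributes one more poset, the one shared by 2413
and 3142.
\<close>

section \<open>Orders, blocks and the forbidden patterns\<close>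

text \<open>The direction is a parameter, so that direct and skew sums are treated at once.\<close>

definition directed :: "bool \<Rightarrow> (nat \<Rightarrow> int) \<Rightarrow> nat set \<Rightarrow> nat set \<Rightarrow> bool" where
  "directed s f X Y \<longleftrightarrow> (\<forall>x\<in>X. \<forall>y\<in>Y. if s then f x < f y else f y < f x)"

definition same_order :: "nat set \<Rightarrow> (nat \<Rightarrow> int) \<Rightarrow> (nat \<Rightarrow> int) \<Rightarrow> bool" where
  "same_order A f g \<longleftrightarrow> (\<forall>x\<in>A. \<forall>y\<in>A. f x < f y \<longleftrightarrow> g x < g y)"

text \<open>The two alternatives are the patterns 2413 and 3142. As each of them is the inverse as well as
the reversal of the other, it does not matter whether \<open>f\<close> maps places to values or values to
places.\<close>

definition avoids :: "(nat \<Rightarrow> int) \<Rightarrow> nat set \<Rightarrow> bool" where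
  "avoids f A \<longleftrightarrow> \<not> (\<exists>i\<in>A. \<exists>j\<in>A. \<exists>k\<in>A. \<exists>l\<in>A. i < j \<and> j < k \<and> k < l \<and>
     (f k < f i \<and> f i < f l \<and> f l < f j \<or> f j < f l \<and> f l < f i \<and> f i < f k))"

text \<open>Convexity of \<open>I\<close> for the order induced by \<open>f\<close>, relative to the ground set \<open>A\<close>. With arbitrary
sets \<open>I\<close> and \<open>A\<close>, the closure of overlapping blocks under set operations is pure order theory, and
blocks pass to subsets of the ground set without any renumbering.\<close>

definition block :: "(nat \<Rightarrow> int) \<Rightarrow> nat set \<Rightarrow> nat set \<Rightarrow> bool" where
  "block f A I \<longleftrightarrow> I \<subseteq> A \<and>
     (\<forall>z\<in>A - I. (\<forall>u\<in>I. f u < f z) \<or> (\<forall>u\<in>I. f z < f u))"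

definition interval_blocks :: "(nat \<Rightarrow> int) \<Rightarrow> nat \<Rightarrow> nat \<Rightarrow> nat set set" where
  "interval_blocks f a b =
     {{x..<y} | x y. a \<le> x \<and> x < y \<and> y \<le> b \<and> block f {a..<b} {x..<y}}"

lemma interval_blocks_iff:
  assumes "x < y" "a \<le> x" "y \<le> b"
  shows "{x..<y} \<in> interval_blocks f a b \<longleftrightarrow> block f {a..<b} {x..<y}"
proof
  assume "{x..<y} \<in> interval_blocks f a b"
  then obtain x' y' where "{x..<y} = {x'..<y'}" "block f {a..<b} {x'..<y'}"
    by (auto simp: interval_blocks_def)
  then show "block f {a..<b} {x..<y}" by simp
qed (use assms in \<open>auto simp: interval_blocks_def\<close>)

lemma interval_blocks_eq_iff:
  "interval_blocks f a b = interval_blocks g a b \<longleftrightarrow>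
   (\<forall>x y. a \<le> x \<longrightarrow> x < y \<longrightarrow> y \<le> b \<longrightarrow>
      (block f {a..<b} {x..<y} \<longleftrightarrow> block g {a..<b} {x..<y}))"
  (is "?l \<longleftrightarrow> ?r")
proof
  assume ?l then show ?r using interval_blocks_iff by metis
next
  assume ?r then show ?l unfolding interval_blocks_def by blast
qed

lemma same_order_sym: "same_order A f g \<Longrightarrow> same_order A g f"
  by (auto simp: same_order_def)

lemma same_order_trans: "same_order A f g \<Longrightarrow> same_order A g h \<Longrightarrow> same_order A f h"
  by (auto simp: same_order_def)

lemma same_order_uminus: "same_order A f g \<Longrightarrow> same_order A (\<lambda>x. - f x) (\<lambda>x. - g x)"
  by (auto simp: same_order_def)

lemma same_order_mono: "same_order A f g \<Longrightarrow> B \<subseteq> A \<Longrightarrow> same_order B f g"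
  unfolding same_order_def by blast

lemma same_order_inj_on:
  assumes "same_order A f g" "inj_on f A" shows "inj_on g A"
proof (rule inj_onI)
  fix x y assume *: "x \<in> A" "y \<in> A" "g x = g y"
  then have "\<not> f x < f y" "\<not> f y < f x" using assms(1) by (auto simp: same_order_def)
  then show "x = y" using * assms(2) by (auto dest: inj_onD)
qed

lemma same_order_directed:
  assumes "same_order A f g" "X \<subseteq> A" "Y \<subseteq> A" "directed s f X Y"
  shows "directed s g X Y"
  using assms by (cases s) (auto simp: same_order_def directed_def subset_iff)

lemma same_order_avoids:
  assumes "same_order A f g" "avoids f A"
  shows "avoids g A"
proof -
  have *: "f x < f y \<longleftrightarrow> g x < g y" if "x \<in> A" "y \<in> A" for x y
    using assms(1) that by (simp add: same_order_def)
  show ?thesis using assms(2) unfolding avoids_def by (simp add: * cong: bex_cong)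
qed

lemma same_order_block:
  assumes "same_order A f g" "block f A I"
  shows "block g A I"
  using assms unfolding same_order_def block_def by (metis DiffD1 subset_iff)

lemma same_order_interval_blocks:
  assumes "same_order {a..<b} f g"
  shows "interval_blocks f a b = interval_blocks g a b"
  using assms unfolding interval_blocks_eq_iff
  by (metis same_order_block same_order_sym)

lemma block_uminus [simp]: "block (\<lambda>x. - f x) A I \<longleftrightarrow> block f A I"
  unfolding block_def by auto

lemma interval_blocks_uminus [simp]: "interval_blocks (\<lambda>x. - f x) a b = interval_blocks f a b"
  by (simp add: interval_blocks_def)

lemma directedD:
  assumes "directed s f X Y" "x \<in> X" "y \<in> Y"
  shows "f x < f y \<longleftrightarrow> s" "f y < f x \<longleftrightarrow> \<not> s"
proof -
  have "if s then f x < f y else f y < f x" using assms unfolding directed_def by blast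
  then show "f x < f y \<longleftrightarrow> s" "f y < f x \<longleftrightarrow> \<not> s" by (auto split: if_splits)
qed

lemma directed_uminus [simp]: "directed s (\<lambda>x. - f x) X Y \<longleftrightarrow> directed (\<not> s) f X Y"
  by (auto simp: directed_def)

lemma directed_sym: "directed s f X Y \<longleftrightarrow> directed (\<not> s) f Y X"
  by (auto simp: directed_def)

lemma avoids_uminus [simp]: "avoids (\<lambda>x. - f x) A \<longleftrightarrow> avoids f A"
  unfolding avoids_def by auto

lemma avoids_mono: "avoids f A \<Longrightarrow> B \<subseteq> A \<Longrightarrow> avoids f B"
  unfolding avoids_def by blast

lemma inj_on_uminus_int [simp]: "inj_on (\<lambda>x. - f x) A \<longleftrightarrow> inj_on f (A :: nat set)" for f :: "nat \<Rightarrow> int"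
  by (auto simp: inj_on_def)

lemma avoidsD:
  assumes "avoids f A" "i \<in> A" "j \<in> A" "k \<in> A" "l \<in> A" "i < j" "j < k" "k < l"
  shows "\<not> (f k < f i \<and> f i < f l \<and> f l < f j)" "\<not> (f j < f l \<and> f l < f i \<and> f i < f k)"
  using assms unfolding avoids_def by blast+

section \<open>Splitting a pattern-avoiding order\<close>

text \<open>Cutting 2413 or 3142 at any place leaves a left part that lies neither entirely below nor
entirely above the right part, so an occurrence cannot straddle the cut.\<close>

lemma avoids_join:
  assumes "directed s f {a..<c} {c..<b}" "avoids f {a..<c}" "avoids f {c..<b}"
  shows "avoids f {a..<b}"
  unfolding avoids_def
proof (intro notI, elim bexE conjE)
  fix i j k l
  assume mem: "i \<in> {a..<b}" "j \<in> {a..<b}" "k \<in> {a..<b}" "l \<in> {a..<b}"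
    and ord: "i < j" "j < k" "k < l"
    and pat: "f k < f i \<and> f i < f l \<and> f l < f j \<or> f j < f l \<and> f l < f i \<and> f i < f k"
  have cross: "if s then f x < f y else f y < f x" if "a \<le> x" "x < c" "c \<le> y" "y < b" for x y
    using assms(1) that by (auto simp: directed_def)
  consider "l < c" | "c \<le> i" | "i < c" "c \<le> j" | "j < c" "c \<le> k" | "k < c" "c \<le> l" by linarith
  then show False
  proof cases
    case 1
    then show False using avoidsD[OF assms(2), of i j k l] mem ord pat by auto
  next
    case 2
    then show False using avoidsD[OF assms(3), of i j k l] mem ord pat by auto
  next
    case 3
    then show False using cross[of i j] cross[of i k] cross[of i l] mem ord pat
      by (auto split: if_splits)
  next
    case 4
    then show False using cross[of i k] cross[of i l] cross[of j k] cross[of j l] mem ord pat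
      by (auto split: if_splits)
  next
    case 5
    then show False using cross[of i l] cross[of k l] cross[of j l] mem ord pat
      by (auto split: if_splits)
  qed
qed

text \<open>Inductive step for the existence of a split: the order is split on all but the last element \<open>b\<close>,
in the direction \<open>True\<close>, and \<open>c\<close> is the earliest such split. If \<open>f b\<close> lies above or below
all values of the first part, a split survives. Otherwise the first part, having no split in
direction \<open>True\<close>, has a skew one. Its left half has an element above \<open>f b\<close> and its right half has
one below \<open>f b\<close>; together with \<open>c\<close> and \<open>b\<close> they form the pattern 3142.\<close>

lemma insert_last_split:
  assumes sub: "a < c" "c < b" and dir: "directed True f {a..<c} {c..<b}"
    and inj: "inj_on f {a..<Suc b}" and av: "avoids f {a..<Suc b}"
    and least: "\<And>c'. a < c' \<Longrightarrow> c' < c \<Longrightarrow> directed True f {a..<c'} {c'..<c} \<Longrightarrow> False"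
    and skew: "Suc a < c \<Longrightarrow> \<exists>d s. a < d \<and> d < c \<and> directed s f {a..<d} {d..<c}"
  shows "\<exists>c s. a < c \<and> c < Suc b \<and> directed s f {a..<c} {c..<Suc b}"
proof -
  have neq: "f x \<noteq> f b" if "a \<le> x" "x < b" for x
    using inj_onD[OF inj, of x b] that by auto
  have dirD: "f x < f y" if "a \<le> x" "x < c" "c \<le> y" "y < b" for x y
    using dir that by (auto simp: directed_def)
  consider "\<forall>x\<in>{a..<c}. f x < f b" | "\<forall>x\<in>{a..<c}. f b < f x"
    | x y where "x \<in> {a..<c}" "y \<in> {a..<c}" "f x < f b" "f b < f y"
    using neq sub by (metis atLeastLessThan_iff linorder_neqE less_trans)
  then show ?thesis
  proof cases
    case 1
    then have "directed True f {a..<c} {c..<Suc b}"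
      using dirD by (auto simp: directed_def less_Suc_eq)
    then show ?thesis using sub by (metis less_Suc_eq)
  next
    case 2
    have "f b < f x" if "a \<le> x" "x < b" for x
      using 2 dirD[of a x] sub that
      by (cases "x < c") (auto intro: less_trans dest!: bspec[of _ _ a])
    then have "directed False f {a..<b} {b..<Suc b}"
      by (auto simp: directed_def less_Suc_eq)
    then show ?thesis using sub by (metis less_trans lessI)
  next
    case 3
    then have "x \<noteq> y" by auto
    then have "Suc a < c" using 3 by auto
    then obtain d s where d: "a < d" "d < c" "directed s f {a..<d} {d..<c}" using skew by blast
    with least have "\<not> s" by (metis (full_types))
    then have sk: "f v < f u" if "a \<le> u" "u < d" "d \<le> v" "v < c" for u v
      using d(3) that by (auto simp: directed_def)
    have "\<exists>u. a \<le> u \<and> u < d \<and> f b < f u"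
    proof (cases "y < d")
      case False
      then have "f y < f a" using sk[of a y] 3 d by auto
      then show ?thesis using 3 d by (intro exI[of _ a]) auto
    qed (use 3 in auto)
    moreover have "\<exists>v. d \<le> v \<and> v < c \<and> f v < f b"
    proof (cases "x < d")
      case True
      then have "f d < f x" using sk[of x d] 3 d by auto
      then show ?thesis using 3 d by (intro exI[of _ d]) auto
    qed (use 3 in \<open>auto intro: exI[of _ x]\<close>)
    ultimately obtain u v where uv: "a \<le> u" "u < d" "f b < f u" "d \<le> v" "v < c" "f v < f b"
      by blast
    have "f u < f c" using dirD[of u c] uv sub d by auto
    then have False using avoidsD[OF av, of u v c b] uv sub d by simp
    then show ?thesis ..
  qed
qed

text \<open>Induction on the last element, by \<open>insert_last_split\<close>. Both directions are covered by passing from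
\<open>f\<close> to its negative if necessary.\<close>

lemma avoids_imp_split:
  assumes "inj_on f {a..<b}" "avoids f {a..<b}" "Suc a < b"
  shows "\<exists>c s. a < c \<and> c < b \<and> directed s f {a..<c} {c..<b}"
  using assms
proof (induction b rule: less_induct)
  case (less b)
  obtain b' where b: "b = Suc b'" using less.prems by (cases b) auto
  have inj: "inj_on f {a..<b'}" and av: "avoids f {a..<b'}"
    using less.prems unfolding b by (auto intro: inj_on_subset avoids_mono)
  show ?case
  proof (cases "Suc a < b'")
    case False
    then have b': "b' = Suc a" using less.prems b by auto
    then have "f a \<noteq> f b'" using less.prems(1) b by (auto dest!: inj_onD[of f _ a b'])
    then have "directed (f a < f b') f {a..<b'} {b'..<b}" using b b' by (auto simp: directed_def)
    then show ?thesis using b b' by blast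
  next
    case True
    obtain c0 s where c0: "a < c0" "c0 < b'" "directed s f {a..<c0} {c0..<b'}"
      using less.IH[of b'] True inj av b by auto
    define P where "P = (\<lambda>c. a < c \<and> c < b' \<and> directed s f {a..<c} {c..<b'})"
    define c where "c = (LEAST c. P c)"
    have "P c" unfolding c_def by (rule LeastI[of P c0]) (use c0 in \<open>simp add: P_def\<close>)
    then have c: "a < c" "c < b'" "directed s f {a..<c} {c..<b'}" by (auto simp: P_def)
    \<comment> \<open>The sign turns the given split into one of direction \<open>True\<close>.\<close>
    define g where "g = (\<lambda>x. if s then f x else - f x)"
    have g_dir: "directed r g X Y \<longleftrightarrow> directed (r = s) f X Y" for r X Y
      by (cases s) (auto simp: g_def)
    have "\<exists>c s. a < c \<and> c < Suc b' \<and> directed s g {a..<c} {c..<Suc b'}"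
    proof (rule insert_last_split)
      show "a < c" "c < b'" by fact+
      show "directed True g {a..<c} {c..<b'}" using c by (simp add: g_dir)
      show "inj_on g {a..<Suc b'}" "avoids g {a..<Suc b'}"
        using less.prems b by (cases s; simp add: g_def)+
      show False if c': "a < c'" "c' < c" "directed True g {a..<c'} {c'..<c}" for c'
      proof -
        have "directed s f {a..<c'} {c'..<b'}"
          unfolding directed_def
        proof (intro ballI)
          fix x y assume xy: "x \<in> {a..<c'}" "y \<in> {c'..<b'}"
          show "if s then f x < f y else f y < f x"
          proof (cases "y < c")
            case True
            then have "y \<in> {c'..<c}" using xy by simp
            then show ?thesis using c'(3) xy(1) unfolding g_dir by (simp add: directed_def)
          next
            case False
            then have "y \<in> {c..<b'}" "x \<in> {a..<c}" using xy c' by auto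
            then show ?thesis using c(3) unfolding directed_def by simp
          qed
        qed
        then have "P c'" using c' c by (simp add: P_def)
        then show False using c' not_less_Least[of c' P] by (simp add: c_def)
      qed
      show "\<exists>d r. a < d \<and> d < c \<and> directed r g {a..<d} {d..<c}" if "Suc a < c"
      proof -
        have "\<exists>d r. a < d \<and> d < c \<and> directed r f {a..<d} {d..<c}"
          using c b that inj av
          by (intro less.IH) (auto intro: inj_on_subset avoids_mono)
        then obtain d r where "a < d" "d < c" "directed r f {a..<d} {d..<c}" by blast
        then show ?thesis unfolding g_dir
          by (intro exI[of _ d] exI[of _ "if s then r else \<not> r"]) (cases s; simp)
      qed
    qed
    then show ?thesis unfolding g_dir b by blast
  qed
qed

section \<open>The blocks determine a pattern-avoiding order up to reversal\<close>

lemma block_relative: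
  assumes "block f A I" "J \<subseteq> I"
  shows "block f I J \<longleftrightarrow> block f A J"
proof
  assume J: "block f I J"
  show "block f A J"
    unfolding block_def
  proof (intro conjI ballI)
    show "J \<subseteq> A" using assms unfolding block_def by blast
  next
    fix z assume "z \<in> A - J"
    then show "(\<forall>u\<in>J. f u < f z) \<or> (\<forall>u\<in>J. f z < f u)"
      using J assms unfolding block_def by (cases "z \<in> I") blast+
  qed
next
  assume "block f A J"
  then show "block f I J" using assms unfolding block_def by blast
qed

lemma directed_imp_blocks:
  assumes "directed s f X Y"
  shows "block f (X \<union> Y) X" "block f (X \<union> Y) Y"
  using assms unfolding block_def directed_def by (cases s; fastforce)+

text \<open>Each of two disjoint blocks lies on one side of every element of the other one, and these sides
must be consistent.\<close>

lemma blocks_imp_directed: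
  assumes "block f A X" "block f A Y" "X \<inter> Y = {}" "x0 \<in> X" "y0 \<in> Y"
  shows "directed (f x0 < f y0) f X Y"
proof -
  have sub: "X \<subseteq> A" "Y \<subseteq> A" using assms unfolding block_def by auto
  have above: "(f x < f y) = (f x0 < f y0) \<and> f x \<noteq> f y" if "x \<in> X" "y \<in> Y" for x y
  proof -
    have "y \<in> A - X" "x0 \<in> A - Y" using that assms sub by auto
    then have "(\<forall>u\<in>X. f u < f y) \<or> (\<forall>u\<in>X. f y < f u)"
      "(\<forall>u\<in>Y. f u < f x0) \<or> (\<forall>u\<in>Y. f x0 < f u)"
      using assms(1,2) unfolding block_def by auto
    then show ?thesis using that assms(4,5) by (metis less_asym' less_irrefl)
  qed
  show ?thesis unfolding directed_def using above by (metis linorder_neqE)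
qed

text \<open>This is how blocks reveal directions: for two nested splits, \<open>X\<close> against \<open>Y\<close> inside \<open>X \<union> Y\<close>
against \<open>Z\<close>, the union of the two neighbours \<open>Y\<close> and \<open>Z\<close> is a block exactly if both splits
have the same direction. Applied from right to left, it also covers nesting in the upper part.\<close>

lemma block_tail_iff:
  assumes "directed s f X Y" "directed r f (X \<union> Y) Z" "X \<noteq> {}" "Y \<noteq> {}" "Z \<noteq> {}"
  shows "block f (X \<union> Y \<union> Z) (Y \<union> Z) \<longleftrightarrow> s = r"
proof
  assume bl: "block f (X \<union> Y \<union> Z) (Y \<union> Z)"
  obtain x y z where xyz: "x \<in> X" "y \<in> Y" "z \<in> Z" using assms(3-5) by blast
  then have 1: "f x < f y \<longleftrightarrow> s" "f x < f z \<longleftrightarrow> r" "f y < f x \<longleftrightarrow> \<not> s" "f z < f x \<longleftrightarrow> \<not> r"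
    using directedD[OF assms(1)] directedD[OF assms(2)] by auto
  then have "x \<notin> Y \<union> Z" using directedD[OF assms(1), of x x] directedD[OF assms(2), of x x] xyz
    by auto
  then have "(\<forall>u\<in>Y \<union> Z. f u < f x) \<or> (\<forall>u\<in>Y \<union> Z. f x < f u)"
    using bl xyz unfolding block_def by blast
  then show "s = r" using xyz 1 by auto
next
  assume "s = r"
  then have "directed s f X (Y \<union> Z)" using assms(1,2) unfolding directed_def by auto
  from directed_imp_blocks(2)[OF this] show "block f (X \<union> Y \<union> Z) (Y \<union> Z)"
    by (simp add: Un_assoc)
qed

lemma interval_blocks_subinterval:
  assumes eq: "interval_blocks f a b = interval_blocks g a b"
    and "block f {a..<b} {c..<d}" "a \<le> c" "c < d" "d \<le> b"
  shows "interval_blocks f c d = interval_blocks g c d"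
proof -
  have g: "block g {a..<b} {c..<d}" using assms unfolding interval_blocks_eq_iff by blast
  show ?thesis
    unfolding interval_blocks_eq_iff
  proof (intro allI impI)
    fix x y assume xy: "c \<le> x" "x < y" "y \<le> d"
    then have sub: "{x..<y} \<subseteq> {c..<d}" by auto
    have "block f {a..<b} {x..<y} \<longleftrightarrow> block g {a..<b} {x..<y}"
      using eq xy assms(3-5) unfolding interval_blocks_eq_iff by auto
    then show "block f {c..<d} {x..<y} \<longleftrightarrow> block g {c..<d} {x..<y}"
      using block_relative[OF assms(2) sub] block_relative[OF g sub] by simp
  qed
qed

text \<open>A split consists of two blocks, so an order with the same blocks splits at the same place, though
perhaps in the other direction. The direction can be read off from the two end points.\<close>

lemma split_transfer:
  assumes eq: "interval_blocks f a b = interval_blocks g a b"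
    and c: "a < c" "c < b" and dir: "directed s f {a..<c} {c..<b}"
  shows "block f {a..<b} {a..<c}" "block f {a..<b} {c..<b}"
    and "directed (g a < g (b - 1)) g {a..<c} {c..<b}"
proof -
  have un: "{a..<c} \<union> {c..<b} = {a..<b}" using c by auto
  show bl: "block f {a..<b} {a..<c}" "block f {a..<b} {c..<b}"
    using directed_imp_blocks[OF dir] un by simp_all
  then have "block g {a..<b} {a..<c}" "block g {a..<b} {c..<b}"
    using eq c unfolding interval_blocks_eq_iff by auto
  then show "directed (g a < g (b - 1)) g {a..<c} {c..<b}"
    by (rule blocks_imp_directed) (use c in auto)
qed

text \<open>Induction along a split of the ground set. The two halves of the split inherit the hypothesis on
the end points because \<open>block_tail_iff\<close> makes the blocks decide whether the next inner split
agrees in direction with the outer one, and on the outer one \<open>f\<close> and \<open>g\<close> agree by assumption.\<close>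

lemma same_ends_imp_same_order:
  assumes "inj_on f {a..<b}" "inj_on g {a..<b}" "avoids f {a..<b}"
    and "interval_blocks f a b = interval_blocks g a b"
    and "f a < f (b - 1) \<longleftrightarrow> g a < g (b - 1)"
  shows "same_order {a..<b} f g"
  using assms
proof (induction "b - a" arbitrary: a b rule: less_induct)
  case less
  note inj = less.prems(1,2) and av = less.prems(3) and eq = less.prems(4) and ends = less.prems(5)
  show ?case
  proof (cases "Suc a < b")
    case False
    then have "x = y" if "x \<in> {a..<b}" "y \<in> {a..<b}" for x y using that by auto
    then show ?thesis unfolding same_order_def by (metis less_irrefl)
  next
    case True
    obtain c s where c: "a < c" "c < b" "directed s f {a..<c} {c..<b}"
      using avoids_imp_split[OF inj(1) av True] by blast
    note bl = split_transfer(1,2)[OF eq c]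
    have g: "directed (g a < g (b - 1)) g {a..<c} {c..<b}"
      using split_transfer(3)[OF eq c] .
    have s: "(f a < f (b - 1)) = s" using c directedD[OF c(3), of a "b - 1"] by auto
    have gs: "directed s g {a..<c} {c..<b}" using g s ends by simp
    have fs: "directed s f {a..<c} {c..<b}" by (rule c)
    have un: "{a..<c} \<union> {c..<b} = {a..<b}" using c by auto
    have eqL: "interval_blocks f a c = interval_blocks g a c"
      by (rule interval_blocks_subinterval[OF eq bl(1)]) (use c in auto)
    have eqR: "interval_blocks f c b = interval_blocks g c b"
      by (rule interval_blocks_subinterval[OF eq bl(2)]) (use c in auto)
    have subL: "{a..<c} \<subseteq> {a..<b}" and subR: "{c..<b} \<subseteq> {a..<b}" using c by auto
    have L: "same_order {a..<c} f g"
    proof (rule less.hyps)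
      show "c - a < b - a" using c by simp
      show "f a < f (c - 1) \<longleftrightarrow> g a < g (c - 1)"
      proof (cases "Suc a < c")
        case False
        then show ?thesis using c by (metis Suc_lessI diff_Suc_1 less_irrefl)
      next
        case True
        then obtain d r where d: "a < d" "d < c" "directed r f {a..<d} {d..<c}"
          using avoids_imp_split[OF inj_on_subset[OF inj(1) subL] avoids_mono[OF av subL]] by blast
        have gd: "directed (g a < g (c - 1)) g {a..<d} {d..<c}" by (rule split_transfer(3)[OF eqL d])
        have r: "(f a < f (c - 1)) = r" using d directedD[OF d(3), of a "c - 1"] by auto
        have un2: "{a..<d} \<union> {d..<c} = {a..<c}" "{d..<c} \<union> {c..<b} = {d..<b}" using c d by auto
        \<comment> \<open>Whether \<open>{d..<b}\<close> is a block tells if the inner split at \<open>d\<close> has the direction of the outer one.\<close>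
        have "block f {a..<b} {d..<b} \<longleftrightarrow> r = s"
          using block_tail_iff[OF d(3), of s "{c..<b}"] fs c d by (simp add: un un2)
        moreover have "block g {a..<b} {d..<b} \<longleftrightarrow> (g a < g (c - 1)) = s"
          using block_tail_iff[OF gd, of s "{c..<b}"] gs c d by (simp add: un un2)
        moreover have "block f {a..<b} {d..<b} \<longleftrightarrow> block g {a..<b} {d..<b}"
          using eq c d unfolding interval_blocks_eq_iff by auto
        ultimately show ?thesis using r by blast
      qed
    qed (use inj av subL eqL in \<open>auto intro: inj_on_subset avoids_mono\<close>)
    have R: "same_order {c..<b} f g"
    proof (rule less.hyps)
      show "b - c < b - a" using c by simp
      show "f c < f (b - 1) \<longleftrightarrow> g c < g (b - 1)"
      proof (cases "Suc c < b")
        case False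
        then show ?thesis using c by (metis Suc_lessI diff_Suc_1 less_irrefl)
      next
        case True
        then obtain d r where d: "c < d" "d < b" "directed r f {c..<d} {d..<b}"
          using avoids_imp_split[OF inj_on_subset[OF inj(1) subR] avoids_mono[OF av subR]] by blast
        have gd: "directed (g c < g (b - 1)) g {c..<d} {d..<b}" by (rule split_transfer(3)[OF eqR d])
        have r: "(f c < f (b - 1)) = r" using d directedD[OF d(3), of c "b - 1"] by auto
        have un2: "{d..<b} \<union> {c..<d} = {c..<b}" "{c..<b} \<union> {a..<c} = {a..<b}"
          "{c..<d} \<union> {a..<c} = {a..<d}" using c d by auto
        \<comment> \<open>The mirror image: the splits are read from right to left, which negates both directions.\<close>
        have "block f {a..<b} {a..<d} \<longleftrightarrow> (\<not> r) = (\<not> s)"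
          using block_tail_iff[of "\<not> r" f "{d..<b}" "{c..<d}" "\<not> s" "{a..<c}"] fs d c
            directed_sym[of r] directed_sym[of s] by (simp add: un2)
        moreover have "block g {a..<b} {a..<d} \<longleftrightarrow> (\<not> (g c < g (b - 1))) = (\<not> s)"
          using block_tail_iff[of "\<not> (g c < g (b - 1))" g "{d..<b}" "{c..<d}" "\<not> s" "{a..<c}"] gs gd d c
            directed_sym[of s] directed_sym[of "g c < g (b - 1)"] by (simp add: un2)
        moreover have "block f {a..<b} {a..<d} \<longleftrightarrow> block g {a..<b} {a..<d}"
          using eq c d unfolding interval_blocks_eq_iff by auto
        ultimately show ?thesis using r by blast
      qed
    qed (use inj av subR eqR in \<open>auto intro: inj_on_subset avoids_mono\<close>)
    show ?thesis
      unfolding same_order_def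
    proof (intro ballI)
      fix x y assume xy: "x \<in> {a..<b}" "y \<in> {a..<b}"
      consider "x < c" "y < c" | "c \<le> x" "c \<le> y" | "x < c" "c \<le> y" | "c \<le> x" "y < c" by linarith
      then show "f x < f y \<longleftrightarrow> g x < g y"
      proof cases
        case 1 then show ?thesis using L xy unfolding same_order_def by auto
      next
        case 2 then show ?thesis using R xy unfolding same_order_def by auto
      next
        case 3
        then have "x \<in> {a..<c}" "y \<in> {c..<b}" using xy by auto
        then show ?thesis using directedD[OF fs] directedD[OF gs] by blast
      next
        case 4
        then have "y \<in> {a..<c}" "x \<in> {c..<b}" using xy by auto
        then show ?thesis using directedD[OF fs] directedD[OF gs] by blast
      qed
    qed
  qed
qed

theorem avoids_imp_unique_up_to_reversal:
  assumes "inj_on f {a..<b}" "inj_on g {a..<b}" "avoids f {a..<b}"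
    and "interval_blocks f a b = interval_blocks g a b"
  shows "same_order {a..<b} f g \<or> same_order {a..<b} f (\<lambda>x. - g x)"
proof (cases "Suc a < b")
  case False
  then have "x = y" if "x \<in> {a..<b}" "y \<in> {a..<b}" for x y using that by auto
  then show ?thesis unfolding same_order_def by (metis less_irrefl)
next
  case True
  then have "g a \<noteq> g (b - 1)" using assms(2) by (auto dest!: inj_onD[of g _ a "b - 1"])
  then consider "f a < f (b - 1) \<longleftrightarrow> g a < g (b - 1)" | "f a < f (b - 1) \<longleftrightarrow> - g a < - g (b - 1)"
    by linarith
  then show ?thesis
  proof cases
    case 1
    then show ?thesis using same_ends_imp_same_order assms by blast
  next
    case 2
    then have "same_order {a..<b} f (\<lambda>x. - g x)"
      using assms by (intro same_ends_imp_same_order) auto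
    then show ?thesis ..
  qed
qed

section \<open>Other orders with the same blocks\<close>

text \<open>A weak form of decomposability: the direction is left open, as it follows from
\<open>blocks_imp_directed\<close>.\<close>

definition splits :: "(nat \<Rightarrow> int) \<Rightarrow> nat set \<Rightarrow> nat \<Rightarrow> nat \<Rightarrow> bool" where
  "splits f A x y \<longleftrightarrow> (\<exists>c. x < c \<and> c < y \<and> block f A {x..<c} \<and> block f A {c..<y})"

lemma block_Un:
  assumes "block f A I" "block f A J" "I \<inter> J \<noteq> {}"
  shows "block f A (I \<union> J)"
  unfolding block_def
proof (intro conjI ballI)
  show "I \<union> J \<subseteq> A" using assms unfolding block_def by blast
next
  fix z assume z: "z \<in> A - (I \<union> J)"
  obtain w where w: "w \<in> I" "w \<in> J" using assms(3) by blast
  have "(\<forall>u\<in>I. f u < f z) \<or> (\<forall>u\<in>I. f z < f u)" "(\<forall>u\<in>J. f u < f z) \<or> (\<forall>u\<in>J. f z < f u)"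
    using assms(1,2) z unfolding block_def by auto
  then show "(\<forall>u\<in>I \<union> J. f u < f z) \<or> (\<forall>u\<in>I \<union> J. f z < f u)"
    using w by (metis Un_iff less_asym)
qed

lemma block_Int:
  assumes "block f A I" "block f A J"
  shows "block f A (I \<inter> J)"
  unfolding block_def
proof (intro conjI ballI)
  show "I \<inter> J \<subseteq> A" using assms unfolding block_def by blast
next
  fix z assume z: "z \<in> A - I \<inter> J"
  show "(\<forall>u\<in>I \<inter> J. f u < f z) \<or> (\<forall>u\<in>I \<inter> J. f z < f u)"
    using assms z unfolding block_def by (cases "z \<in> I") blast+
qed

text \<open>If \<open>w\<close> belongs to \<open>J\<close> but not to \<open>I\<close>, say with \<open>w\<close> above \<open>I\<close>, then elements of \<open>I - J\<close> lie below
\<open>w\<close> and hence below all of \<open>J\<close>, in particular below the common elements of \<open>I\<close> and \<open>J\<close>.\<close>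

lemma block_Diff:
  assumes "block f A I" "block f A J" "I \<inter> J \<noteq> {}" "J - I \<noteq> {}"
  shows "block f A (I - J)"
  unfolding block_def
proof (intro conjI ballI)
  show "I - J \<subseteq> A" using assms unfolding block_def by blast
next
  fix z assume z: "z \<in> A - (I - J)"
  show "(\<forall>u\<in>I - J. f u < f z) \<or> (\<forall>u\<in>I - J. f z < f u)"
  proof (cases "z \<in> I")
    case False
    then have "z \<in> A - I" using z by simp
    then show ?thesis using assms(1) unfolding block_def by blast
  next
    case True
    then have zJ: "z \<in> J" using z by simp
    obtain w where w: "w \<in> J" "w \<notin> I" using assms(4) by blast
    then have wA: "w \<in> A - I" using assms(2) unfolding block_def by blast
    have J: "(\<forall>v\<in>J. f v < f u) \<or> (\<forall>v\<in>J. f u < f v)" if "u \<in> I - J" for u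
      using assms(1,2) that unfolding block_def by blast
    from wA assms(1) consider "\<forall>u\<in>I. f u < f w" | "\<forall>u\<in>I. f w < f u"
      unfolding block_def by blast
    then show ?thesis
    proof cases
      case 1
      then have "f u < f z" if "u \<in> I - J" for u using J[OF that] that w zJ by (metis DiffD1 less_asym)
      then show ?thesis by blast
    next
      case 2
      then have "f z < f u" if "u \<in> I - J" for u using J[OF that] that w zJ by (metis DiffD1 less_asym)
      then show ?thesis by blast
    qed
  qed
qed

lemma overlap_imp_splits:
  assumes "block f A {x..<y}" "block f A {u..<v}" "{x..<y} \<inter> {u..<v} \<noteq> {}"
    and "\<not> {x..<y} \<subseteq> {u..<v}" "\<not> {u..<v} \<subseteq> {x..<y}"
  shows "splits f A x y"
proof -
  have bl: "block f A ({x..<y} \<inter> {u..<v})" "block f A ({x..<y} - {u..<v})"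
    by (rule block_Int block_Diff; use assms in blast)+
  have *: "max x u < min y v" "x < u \<and> y < v \<or> u < x \<and> v < y" using assms(3-5) by auto
  from *(2) show ?thesis
  proof
    assume c: "x < u \<and> y < v"
    then have "{x..<y} \<inter> {u..<v} = {u..<y}" "{x..<y} - {u..<v} = {x..<u}" using * by auto
    then show ?thesis using bl c * unfolding splits_def by (intro exI[of _ u]) auto
  next
    assume c: "u < x \<and> v < y"
    then have "{x..<y} \<inter> {u..<v} = {x..<v}" "{x..<y} - {u..<v} = {v..<y}" using * by auto
    then show ?thesis using bl c * unfolding splits_def by (intro exI[of _ v]) auto
  qed
qed

text \<open>The converse of \<open>avoids_imp_split\<close> in the form in which it is needed: an occurrence of a
pattern forces an unsplittable block.\<close>

lemma all_split_imp_avoids: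
  assumes "\<And>x y. a \<le> x \<Longrightarrow> Suc x < y \<Longrightarrow> y \<le> b \<Longrightarrow> block f {a..<b} {x..<y} \<Longrightarrow> splits f {a..<b} x y"
  shows "avoids f {a..<b}"
proof -
  have "avoids f {x..<y}" if "a \<le> x" "y \<le> b" "block f {a..<b} {x..<y}" for x y
    using that
  proof (induction "y - x" arbitrary: x y rule: less_induct)
    case less
    show ?case
    proof (cases "Suc x < y")
      case False
      then show ?thesis unfolding avoids_def by auto
    next
      case True
      then obtain c where c: "x < c" "c < y" "block f {a..<b} {x..<c}" "block f {a..<b} {c..<y}"
        using assms less.prems unfolding splits_def by blast
      then have "directed (f x < f c) f {x..<c} {c..<y}"
        by (intro blocks_imp_directed) auto
      then show ?thesis using less c by (intro avoids_join[of _ f x c y]) auto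
    qed
  qed
  moreover have "block f {a..<b} {a..<b}" by (simp add: block_def)
  ultimately show ?thesis by blast
qed

text \<open>The order \<open>g\<close> arises from \<open>f\<close> by reversing it inside \<open>J\<close>. Stating this by comparisons, and not
by a formula for \<open>g\<close>, makes the relation symmetric in \<open>f\<close> and \<open>g\<close>.\<close>

definition flips :: "nat set \<Rightarrow> nat set \<Rightarrow> (nat \<Rightarrow> int) \<Rightarrow> (nat \<Rightarrow> int) \<Rightarrow> bool" where
  "flips A J f g \<longleftrightarrow> (\<forall>x\<in>A. \<forall>y\<in>A. g x < g y \<longleftrightarrow> (if x \<in> J \<and> y \<in> J then f y < f x else f x < f y))"

lemma flips_sym: "flips A J f g \<Longrightarrow> flips A J g f"
  unfolding flips_def by auto

text \<open>Reflecting the values on \<open>J\<close> at the middle of their range keeps them in that range, and as \<open>J\<close>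
is a block, no other value lies in it.\<close>

lemma ex_flips:
  assumes "block f A J" "finite J" "inj_on f A"
  shows "\<exists>g. flips A J f g \<and> inj_on g A"
proof (cases "J = {}")
  case True
  then show ?thesis using assms(3) by (auto simp: flips_def)
next
  case False
  define lo hi where "lo = Min (f ` J)" and "hi = Max (f ` J)"
  define g where "g x = (if x \<in> J then lo + hi - f x else f x)" for x
  have lo: "lo \<in> f ` J" "\<And>x. x \<in> J \<Longrightarrow> lo \<le> f x" and hi: "hi \<in> f ` J" "\<And>x. x \<in> J \<Longrightarrow> f x \<le> hi"
    using assms(2) False by (auto simp: lo_def hi_def)
  have JA: "J \<subseteq> A" using assms(1) unfolding block_def by blast
  have out: "f z < lo \<or> hi < f z" if "z \<in> A - J" for z
    using assms(1) that lo(1) hi(1) unfolding block_def by blast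
  have fl: "flips A J f g"
    unfolding flips_def
  proof (intro ballI)
    fix x y assume "x \<in> A" "y \<in> A"
    then show "g x < g y \<longleftrightarrow> (if x \<in> J \<and> y \<in> J then f y < f x else f x < f y)"
      using out[of x] out[of y] lo(2)[of x] lo(2)[of y] hi(2)[of x] hi(2)[of y]
      by (auto simp: g_def)
  qed
  have "inj_on g A"
  proof (rule inj_onI)
    fix x y assume xy: "x \<in> A" "y \<in> A" "g x = g y"
    then have "f x = f y"
      using out[of x] out[of y] lo(2)[of x] lo(2)[of y] hi(2)[of x] hi(2)[of y]
      by (auto simp: g_def split: if_splits)
    then show "x = y" using xy assms(3) by (auto dest: inj_onD)
  qed
  then show ?thesis using fl by blast
qed

text \<open>Between an element outside \<open>K\<close> and the elements of \<open>K\<close>, a flip of \<open>J\<close> reverses either all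
comparisons or none, unless \<open>J\<close> and \<open>K\<close> overlap.\<close>

lemma flips_block:
  assumes "flips A J f g" "K \<subseteq> A" "K \<subseteq> J \<or> J \<subseteq> K \<or> K \<inter> J = {}" "block f A K"
  shows "block g A K"
  unfolding block_def
proof (intro conjI ballI)
  show "K \<subseteq> A" by fact
next
  fix z assume z: "z \<in> A - K"
  have g: "g x < g y \<longleftrightarrow> (if x \<in> J \<and> y \<in> J then f y < f x else f x < f y)" if "x \<in> A" "y \<in> A" for x y
    using assms(1) that unfolding flips_def by blast
  have f: "(\<forall>u\<in>K. f u < f z) \<or> (\<forall>u\<in>K. f z < f u)"
    using assms(4) z unfolding block_def by blast
  have "K \<subseteq> J \<or> z \<notin> J \<or> K \<inter> J = {}" using assms(3) z by blast
  then consider "K \<subseteq> J" "z \<in> J" | "\<forall>u\<in>K. \<not> (u \<in> J \<and> z \<in> J)" by blast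
  then show "(\<forall>u\<in>K. g u < g z) \<or> (\<forall>u\<in>K. g z < g u)"
  proof cases
    case 1
    then have "\<forall>u\<in>K. (g u < g z \<longleftrightarrow> f z < f u) \<and> (g z < g u \<longleftrightarrow> f u < f z)"
      using g z assms(2) by (simp add: subset_iff)
    then show ?thesis using f by blast
  next
    case 2
    then have "\<forall>u\<in>K. (g u < g z \<longleftrightarrow> f u < f z) \<and> (g z < g u \<longleftrightarrow> f z < f u)"
      using g z assms(2) by (auto simp: subset_iff)
    then show ?thesis using f by blast
  qed
qed

text \<open>The flipped order has the same blocks if no block of either order overlaps the flipped one. It
differs from \<open>f\<close> inside the flipped block, and from the reversal of \<open>f\<close> in comparisons of that block
with an element outside.\<close>

lemma flip_gives_new_order:
  assumes fl: "flips {a..<b} {x..<y} f g" and xy: "a \<le> x" "Suc x < y" "y \<le> b"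
    and proper: "{x..<y} \<noteq> {a..<b}" and inj: "inj_on f {a..<b}"
    and no: "\<And>h u v. h = f \<or> h = g \<Longrightarrow> block h {a..<b} {u..<v} \<Longrightarrow>
        {u..<v} \<inter> {x..<y} \<noteq> {} \<Longrightarrow> {u..<v} \<subseteq> {x..<y} \<or> {x..<y} \<subseteq> {u..<v}"
  shows "interval_blocks f a b = interval_blocks g a b"
    and "\<not> same_order {a..<b} f g" and "\<not> same_order {a..<b} f (\<lambda>x. - g x)"
proof -
  show "interval_blocks f a b = interval_blocks g a b"
    unfolding interval_blocks_eq_iff
  proof (intro allI impI iffI)
    fix u v assume uv: "a \<le> u" "u < v" "v \<le> b"
    then have sub: "{u..<v} \<subseteq> {a..<b}" by auto
    show "block g {a..<b} {u..<v}" if "block f {a..<b} {u..<v}"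
      using no[of f u v] that by (intro flips_block[OF fl sub]) auto
    show "block f {a..<b} {u..<v}" if "block g {a..<b} {u..<v}"
      using no[of g u v] that by (intro flips_block[OF flips_sym[OF fl] sub]) auto
  qed
  have mem: "x \<in> {a..<b}" "Suc x \<in> {a..<b}" "x \<in> {x..<y}" "Suc x \<in> {x..<y}" using xy by auto
  have g: "g u < g v \<longleftrightarrow> (if u \<in> {x..<y} \<and> v \<in> {x..<y} then f v < f u else f u < f v)"
    if "u \<in> {a..<b}" "v \<in> {a..<b}" for u v
    using fl that unfolding flips_def by blast
  have "f x \<noteq> f (Suc x)" using inj mem by (metis inj_onD n_not_Suc_n)
  moreover have "g x < g (Suc x) \<longleftrightarrow> f (Suc x) < f x" using g mem by simp
  ultimately show "\<not> same_order {a..<b} f g"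
    using mem unfolding same_order_def by (meson linorder_neqE less_asym)
  have "\<not> {a..<b} \<subseteq> {x..<y}" using proper xy by auto
  then obtain z where z: "z \<in> {a..<b}" "z \<notin> {x..<y}" by blast
  then have "f x \<noteq> f z" using inj mem by (metis inj_onD)
  moreover have "g x < g z \<longleftrightarrow> f x < f z" "g z < g x \<longleftrightarrow> f z < f x" using g mem z by auto
  ultimately show "\<not> same_order {a..<b} f (\<lambda>x. - g x)"
    using mem z unfolding same_order_def by (metis linorder_neqE less_asym neg_less_iff_less)
qed

definition simple :: "(nat \<Rightarrow> int) \<Rightarrow> nat \<Rightarrow> bool" where
  "simple f n \<longleftrightarrow> inj_on f {1..<1 + n} \<and>
     (\<forall>x y. 1 \<le> x \<longrightarrow> Suc x < y \<longrightarrow> y \<le> 1 + n \<longrightarrow> block f {1..<1 + n} {x..<y} \<longrightarrow> x = 1 \<and> y = 1 + n)"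

lemma simple_interval_blocks_eq:
  assumes "simple f n" "simple g n"
  shows "interval_blocks f 1 (1 + n) = interval_blocks g 1 (1 + n)"
proof -
  have sing: "block f {1..<1 + n} {x..<y}" if "inj_on f {1..<1 + n}" "1 \<le> x" "y = Suc x" "y \<le> 1 + n" for f x y
    unfolding block_def
  proof (intro conjI ballI)
    show "{x..<y} \<subseteq> {1..<1 + n}" using that by auto
  next
    fix z assume z: "z \<in> {1..<1 + n} - {x..<y}"
    then have "f z \<noteq> f x" using that by (auto dest: inj_onD)
    then show "(\<forall>u\<in>{x..<y}. f u < f z) \<or> (\<forall>u\<in>{x..<y}. f z < f u)" using that by auto
  qed
  have whole: "block f A A" for f A by (simp add: block_def)
  have "block f {1..<1 + n} {x..<y} \<longleftrightarrow> y = Suc x \<or> x = 1 \<and> y = 1 + n"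
    if "simple f n" "1 \<le> x" "x < y" "y \<le> 1 + n" for f x y
    using that sing[of f x y] whole[of f "{1..<1 + n}"] unfolding simple_def by (metis Suc_lessI)
  then show ?thesis using assms unfolding interval_blocks_eq_iff by blast
qed

text \<open>A new last element keeps an order simple if its value is neither extreme nor adjacent to the
value \<open>f n\<close> of its neighbour: a block of at least two elements
that contains the new one restricts to a block of the
old order, hence consists of the last two elements or of everything. Two old values \<open>f p < f q\<close> on
the same side of \<open>f n\<close> provide a suitable place between them, and they exist because at
least three old values differ from \<open>f n\<close>.\<close>

lemma simple_extend:
  assumes f: "simple f n" and n: "4 \<le> n"
  shows "\<exists>g. simple g (Suc n) \<and> same_order {1..<1 + n} f g"
proof -
  have inj: "inj_on f {1..<1 + n}" using f by (simp add: simple_def)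
  define U where "U = {x \<in> {1..<n}. f n < f x}"
  define L where "L = {x \<in> {1..<n}. f x < f n}"
  have "U \<union> L = {1..<n}"
  proof -
    have "f x \<noteq> f n" if "x \<in> {1..<n}" for x
      using inj that by (auto dest!: inj_onD[of f _ x n])
    then show ?thesis by (force simp: U_def L_def)
  qed
  moreover have "card (U \<union> L) \<le> card U + card L" by (rule card_Un_le)
  ultimately have "n - 1 \<le> card U + card L" by simp
  then have "2 \<le> card U \<or> 2 \<le> card L" using n by linarith
  then obtain p q where pq: "p \<in> {1..<n}" "q \<in> {1..<n}" "f p < f q"
    "f n < f p \<or> f q < f n"
  proof
    assume "2 \<le> card U"
    then obtain p q where "p \<in> U" "q \<in> U" "p \<noteq> q"
      by (metis (no_types, opaque_lifting) card_le_Suc0_iff_eq card.infinite not_less_eq_eq numeral_2_eq_2 zero_le)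
    moreover have "f p \<noteq> f q" using inj calculation by (auto simp: U_def dest!: inj_onD[of f _ p q])
    ultimately show ?thesis using that[of p q] that[of q p] by (cases "f p < f q") (auto simp: U_def)
  next
    assume "2 \<le> card L"
    then obtain p q where "p \<in> L" "q \<in> L" "p \<noteq> q"
      by (metis (no_types, opaque_lifting) card_le_Suc0_iff_eq card.infinite not_less_eq_eq numeral_2_eq_2 zero_le)
    moreover have "f p \<noteq> f q" using inj calculation by (auto simp: L_def dest!: inj_onD[of f _ p q])
    ultimately show ?thesis using that[of p q] that[of q p] by (cases "f p < f q") (auto simp: L_def)
  qed
  \<comment> \<open>Old values are doubled, so that the odd value \<open>2 * w + 1\<close> is free; it lies between those of \<open>p\<close> and \<open>q\<close>.\<close>
  define w where "w = (if f n < f p then f p else f q - 1)"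
  define g where "g x = (if x \<le> n then 2 * f x else 2 * w + 1)" for x
  have gn: "g (Suc n) = 2 * w + 1" by (simp add: g_def)
  have gle: "g x = 2 * f x" if "x \<le> n" for x using that by (simp add: g_def)
  have so: "same_order {1..<1 + n} f g" by (auto simp: same_order_def g_def)
  have inj_g: "inj_on g {1..<1 + Suc n}"
  proof (rule inj_onI)
    fix x y assume xy: "x \<in> {1..<1 + Suc n}" "y \<in> {1..<1 + Suc n}" "g x = g y"
    have "2 * f u \<noteq> 2 * w + 1" for u by presburger
    then show "x = y" using xy inj unfolding g_def
      by (auto split: if_splits dest: inj_onD)
  qed
  have "x = 1 \<and> y = 1 + Suc n"
    if xy: "1 \<le> x" "Suc x < y" "y \<le> 1 + Suc n" and bl: "block g {1..<1 + Suc n} {x..<y}" for x y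
  proof -
    have cmp: "(\<forall>u\<in>{x..<y}. g u < g z) \<or> (\<forall>u\<in>{x..<y}. g z < g u)" if "1 \<le> z" "z \<le> Suc n" "z \<notin> {x..<y}" for z
      using bl that unfolding block_def by auto
    have restr: "block f {1..<1 + n} {x..<min y (1 + n)}"
      unfolding block_def
    proof (intro conjI ballI)
      show "{x..<min y (1 + n)} \<subseteq> {1..<1 + n}" using xy by auto
    next
      fix z assume z: "z \<in> {1..<1 + n} - {x..<min y (1 + n)}"
      then have "(\<forall>u\<in>{x..<y}. g u < g z) \<or> (\<forall>u\<in>{x..<y}. g z < g u)"
        by (intro cmp) auto
      moreover have "(g u < g z \<longleftrightarrow> f u < f z) \<and> (g z < g u \<longleftrightarrow> f z < f u)"
        if "u \<in> {x..<min y (1 + n)}" for u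
        using that z gle[of u] gle[of z] by auto
      moreover have "{x..<min y (1 + n)} \<subseteq> {x..<y}" by auto
      ultimately show "(\<forall>u\<in>{x..<min y (1 + n)}. f u < f z) \<or> (\<forall>u\<in>{x..<min y (1 + n)}. f z < f u)"
        by blast
    qed
    show ?thesis
    proof (cases "y = 1 + Suc n")
      case False
      then have y: "y \<le> 1 + n" "min y (1 + n) = y" using xy by auto
      then have "x = 1" "y = 1 + n" using f xy restr unfolding simple_def by auto
      then have "(\<forall>u\<in>{1..<1 + n}. g u < g (Suc n)) \<or> (\<forall>u\<in>{1..<1 + n}. g (Suc n) < g u)"
        using cmp[of "Suc n"] by simp
      then have "g p < g (Suc n) \<and> g q < g (Suc n) \<and> g n < g (Suc n) \<or>
          g (Suc n) < g p \<and> g (Suc n) < g q \<and> g (Suc n) < g n"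
        using pq n by auto
      then show ?thesis using pq unfolding gn w_def by (auto simp: gle split: if_splits)
    next
      case True
      show ?thesis
      proof (cases "Suc x < 1 + n")
        case True
        then have "x = 1" using f xy restr \<open>y = 1 + Suc n\<close> unfolding simple_def by auto
        then show ?thesis using \<open>y = 1 + Suc n\<close> by simp
      next
        case False
        then have x: "x = n" using xy by auto
        then have "(g n < g p \<and> g (Suc n) < g p \<or> g p < g n \<and> g p < g (Suc n)) \<and>
           (g n < g q \<and> g (Suc n) < g q \<or> g q < g n \<and> g q < g (Suc n))"
          using cmp[of p] cmp[of q] pq True by auto
        then show ?thesis using pq unfolding gn w_def by (auto simp: gle split: if_splits)
      qed
    qed
  qed
  then have "simple g (Suc n)" using inj_g unfolding simple_def by blast
  then show ?thesis using so by blast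
qed

text \<open>The orders 24153 and 41352. Size 5 is the first size with more than one pair of simple
permutations.\<close>

lemma ex_two_simple_five:
  "\<exists>f g. simple f 5 \<and> simple g 5 \<and> \<not> same_order {1..<1 + 5} f g \<and>
     \<not> same_order {1..<1 + 5} f (\<lambda>x. - g x)"
proof -
  have S: "{1..<1 + 5} = {1, 2, 3, 4, 5 :: nat}" by auto
  have simpleI: "simple h 5"
    if inj: "inj_on h {1..<1 + 5}"
      and w: "\<And>x y. 1 \<le> x \<Longrightarrow> Suc x < y \<Longrightarrow> y \<le> 6 \<Longrightarrow> x \<noteq> 1 \<or> y \<noteq> 6 \<Longrightarrow>
        \<exists>z u v. 1 \<le> z \<and> z \<le> 5 \<and> (z < x \<or> y \<le> z) \<and> x \<le> u \<and> u < y \<and> x \<le> v \<and> v < y \<and>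
          h u < h z \<and> h z < h v" for h
    unfolding simple_def
  proof (intro conjI allI impI inj)
    fix x y :: nat
    assume xy: "1 \<le> x" "Suc x < y" "y \<le> 1 + 5" and bl: "block h {1..<1 + 5} {x..<y}"
    have no: "\<not> (h u < h z \<and> h z < h v)"
      if "1 \<le> z" "z \<le> 5" "z < x \<or> y \<le> z" "x \<le> u" "u < y" "x \<le> v" "v < y" for z u v
    proof -
      have "z \<in> {1..<1 + 5} - {x..<y}" "u \<in> {x..<y}" "v \<in> {x..<y}" using that by auto
      then show ?thesis using bl unfolding block_def by (meson less_asym)
    qed
    have "\<not> (x \<noteq> 1 \<or> y \<noteq> 6)" using w[of x y] no xy by fastforce
    then show "x = 1" "y = 1 + 5" by auto
  qed
  define f :: "nat \<Rightarrow> int" where "f x = [2, 4, 1, 5, 3] ! (x - 1)" for x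
  define g :: "nat \<Rightarrow> int" where "g x = [4, 1, 3, 5, 2] ! (x - 1)" for x
  have f: "f 1 = 2" "f 2 = 4" "f 3 = 1" "f 4 = 5" "f 5 = 3" by (simp_all add: f_def)
  have g: "g 1 = 4" "g 2 = 1" "g 3 = 3" "g 4 = 5" "g 5 = 2" by (simp_all add: g_def)
  have "inj_on f {1..<1 + 5}" "inj_on g {1..<1 + 5}"
    unfolding S inj_on_def by (simp_all add: f g del: One_nat_def)
  have "simple f 5"
  proof (rule simpleI)
    fix x y :: nat assume xy: "1 \<le> x" "Suc x < y" "y \<le> 6" "x \<noteq> 1 \<or> y \<noteq> 6"
    then consider "x = 1" "y \<le> 5" | "x = 2" | "x = 3" | "x = 4" by linarith
    then show "\<exists>z u v. 1 \<le> z \<and> z \<le> 5 \<and> (z < x \<or> y \<le> z) \<and> x \<le> u \<and> u < y \<and> x \<le> v \<and> v < y \<and>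
          f u < f z \<and> f z < f v"
    proof cases
      case 1 then show ?thesis using xy f by (intro exI[of _ 5] exI[of _ 1] exI[of _ 2]) auto
    next
      case 2 then show ?thesis using xy f by (intro exI[of _ 1] exI[of _ 3] exI[of _ 2]) auto
    next
      case 3 then show ?thesis using xy f by (intro exI[of _ 1] exI[of _ 3] exI[of _ 4]) auto
    next
      case 4 then show ?thesis using xy f by (intro exI[of _ 2] exI[of _ 5] exI[of _ 4]) auto
    qed
  qed fact
  moreover have "simple g 5"
  proof (rule simpleI)
    fix x y :: nat assume xy: "1 \<le> x" "Suc x < y" "y \<le> 6" "x \<noteq> 1 \<or> y \<noteq> 6"
    then consider "x = 1" "y \<le> 5" | "x = 2" "y = 4" | "x = 2" "5 \<le> y" | "x = 3" | "x = 4" by linarith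
    then show "\<exists>z u v. 1 \<le> z \<and> z \<le> 5 \<and> (z < x \<or> y \<le> z) \<and> x \<le> u \<and> u < y \<and> x \<le> v \<and> v < y \<and>
          g u < g z \<and> g z < g v"
    proof cases
      case 1 then show ?thesis using xy g by (intro exI[of _ 5] exI[of _ 2] exI[of _ 1]) auto
    next
      case 2 then show ?thesis using xy g by (intro exI[of _ 5] exI[of _ 2] exI[of _ 3]) auto
    next
      case 3 then show ?thesis using xy g by (intro exI[of _ 1] exI[of _ 2] exI[of _ 4]) auto
    next
      case 4 then show ?thesis using xy g by (intro exI[of _ 1] exI[of _ 3] exI[of _ 4]) auto
    next
      case 5 then show ?thesis using xy g by (intro exI[of _ 1] exI[of _ 5] exI[of _ 4]) auto
    qed
  qed fact
  moreover have "\<not> same_order {1..<1 + 5} f g" "\<not> same_order {1..<1 + 5} f (\<lambda>x. - g x)"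
    unfolding same_order_def S by (simp_all add: f g del: One_nat_def)
  ultimately show ?thesis by blast
qed

text \<open>Extending two orders that are neither equal nor opposite keeps them so, because their
restrictions can be recovered.\<close>

lemma ex_two_simple:
  assumes "5 \<le> n"
  shows "\<exists>f g. simple f n \<and> simple g n \<and> \<not> same_order {1..<1 + n} f g \<and>
     \<not> same_order {1..<1 + n} f (\<lambda>x. - g x)"
  using assms
proof (induction n rule: dec_induct)
  case base
  show ?case by (rule ex_two_simple_five)
next
  case (step n)
  then obtain f g where fg: "simple f n" "simple g n" "\<not> same_order {1..<1 + n} f g"
    "\<not> same_order {1..<1 + n} f (\<lambda>x. - g x)" by blast
  obtain f' g' where f': "simple f' (Suc n)" "same_order {1..<1 + n} f f'"
    and g': "simple g' (Suc n)" "same_order {1..<1 + n} g g'"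
    using simple_extend[of f n] simple_extend[of g n] fg step by auto
  have sub: "{1..<1 + n} \<subseteq> {1..<1 + Suc n}" by auto
  have "\<not> same_order {1..<1 + Suc n} f' g'"
    using fg(3) f'(2) g'(2) same_order_mono[OF _ sub] same_order_trans same_order_sym by metis
  moreover have "\<not> same_order {1..<1 + Suc n} f' (\<lambda>x. - g' x)"
    using fg(4) f'(2) same_order_uminus[OF g'(2)] same_order_mono[OF _ sub] same_order_trans same_order_sym
    by metis
  ultimately show ?case using f' g' by blast
qed

lemma same_order_uminus_right: "same_order A f (\<lambda>x. - g x) \<Longrightarrow> same_order A g (\<lambda>x. - f x)"
  using same_order_uminus[of A f "\<lambda>x. - g x"] same_order_sym by simp

text \<open>Three cases, for an unsplittable block \<open>{x..<y}\<close>. A proper one is flipped. If it is everything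
and the order is simple, one of two essentially different simple orders of the same size is new.
Otherwise a longest proper block of at least two elements is flipped: a block overlapping it
would, by maximality, complete it to the whole ground set and thereby split the ground set.\<close>

theorem not_avoids_imp_other_order:
  assumes inj: "inj_on f {1..<1 + n}" and nav: "\<not> avoids f {1..<1 + n}" and n: "5 \<le> n"
  shows "\<exists>g. inj_on g {1..<1 + n} \<and> interval_blocks f 1 (1 + n) = interval_blocks g 1 (1 + n) \<and>
    \<not> same_order {1..<1 + n} f g \<and> \<not> same_order {1..<1 + n} f (\<lambda>x. - g x)"
proof -
  let ?A = "{1..<1 + n}"
  obtain x y where xy: "1 \<le> x" "Suc x < y" "y \<le> 1 + n" "block f ?A {x..<y}" "\<not> splits f ?A x y"
    using all_split_imp_avoids[of 1 "1 + n" f] nav by blast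
  show ?thesis
  proof (cases "{x..<y} = ?A")
    case False
    obtain g where g: "flips ?A {x..<y} f g" "inj_on g ?A"
      using ex_flips[OF xy(4) _ inj] by auto
    have "block g ?A {x..<y}" using xy by (intro flips_block[OF g(1)]) auto
    moreover have "\<not> splits g ?A x y"
    proof
      assume "splits g ?A x y"
      then obtain c where c: "x < c" "c < y" "block g ?A {x..<c}" "block g ?A {c..<y}"
        unfolding splits_def by blast
      have "block f ?A {x..<c}" "block f ?A {c..<y}"
        by (rule flips_block[OF flips_sym[OF g(1)]]; use xy c in auto)+
      then show False using xy(5) c unfolding splits_def by blast
    qed
    ultimately have no: "{u..<v} \<subseteq> {x..<y} \<or> {x..<y} \<subseteq> {u..<v}"
      if "h = f \<or> h = g" "block h ?A {u..<v}" "{u..<v} \<inter> {x..<y} \<noteq> {}" for h u v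
      using overlap_imp_splits[of h ?A x y u v] that xy by (metis Int_commute)
    show ?thesis
      using flip_gives_new_order[OF g(1) xy(1-3) False inj no] g(2) by (intro exI[of _ g] conjI)
  next
    case True
    then have "x = 1" "y = 1 + n" using atLeastLessThan_inj[OF True] xy n by auto
    then have nosplit: "\<not> splits f ?A 1 (1 + n)" using xy by simp
    show ?thesis
    proof (cases "simple f n")
      case True
      obtain g h where gh: "simple g n" "simple h n" "\<not> same_order ?A g h"
        "\<not> same_order ?A g (\<lambda>x. - h x)"
        using ex_two_simple[OF n] by blast
      have "\<not> same_order ?A f g \<and> \<not> same_order ?A f (\<lambda>x. - g x) \<or>
        \<not> same_order ?A f h \<and> \<not> same_order ?A f (\<lambda>x. - h x)"
      proof (rule ccontr)
        assume neg: "\<not> ?thesis"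
        then consider "same_order ?A f g" | "same_order ?A f (\<lambda>x. - g x)" by blast
        then show False
        proof cases
          case 1
          then show False using neg gh(3,4) same_order_sym same_order_trans by metis
        next
          case 2
          then have gf: "same_order ?A g (\<lambda>x. - f x)" by (rule same_order_uminus_right)
          from neg consider "same_order ?A f h" | "same_order ?A f (\<lambda>x. - h x)" by blast
          then show False
          proof cases
            case 1
            from same_order_trans[OF gf same_order_uminus[OF this]] show False using gh(4) by simp
          next
            case 2
            from same_order_trans[OF gf same_order_uminus[OF this]] show False using gh(3) by simp
          qed
        qed
      qed
      moreover have "inj_on g ?A" "inj_on h ?A" using gh by (auto simp: simple_def)
      ultimately show ?thesis
        using simple_interval_blocks_eq[OF True gh(1)] simple_interval_blocks_eq[OF True gh(2)]
        by blast
    next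
      case False
      \<comment> \<open>Lengths of the proper blocks with at least two elements.\<close>
      define P where "P l \<longleftrightarrow> (\<exists>x y. 1 \<le> x \<and> Suc x < y \<and> y \<le> 1 + n \<and> block f ?A {x..<y} \<and>
        {x..<y} \<noteq> ?A \<and> l = y - x)" for l
      have "\<exists>l. P l" using False inj unfolding simple_def P_def by fastforce
      moreover have "\<forall>l. P l \<longrightarrow> l \<le> n" unfolding P_def by auto
      ultimately obtain l where l: "P l" "\<And>l'. P l' \<Longrightarrow> l' \<le> l"
        by (metis GreatestI_ex_nat Greatest_le_nat)
      then obtain p q where pq: "1 \<le> p" "Suc p < q" "q \<le> 1 + n" "block f ?A {p..<q}"
        "{p..<q} \<noteq> ?A" "l = q - p" unfolding P_def by blast
      let ?J = "{p..<q}"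
      obtain g where g: "flips ?A ?J f g" "inj_on g ?A"
        using ex_flips[OF pq(4) _ inj] by auto
      have to_f: "block f ?A K" if "block h ?A K" "h = f \<or> h = g" "K \<subseteq> ?J \<or> ?J \<subseteq> K \<or> K \<inter> ?J = {}" for h K
        using that flips_block[OF flips_sym[OF g(1)], of K] by (auto simp: block_def)
      have J: "block h ?A ?J" if "h = f \<or> h = g" for h
        using that flips_block[OF g(1), of ?J] pq by auto
      have no: "{u..<v} \<subseteq> ?J \<or> ?J \<subseteq> {u..<v}"
        if h: "h = f \<or> h = g" and uv: "block h ?A {u..<v}" "{u..<v} \<inter> ?J \<noteq> {}" for h u v
      proof (rule ccontr)
        assume over: "\<not> ?thesis"
        have uv_sub: "{u..<v} \<subseteq> ?A" using uv(1) unfolding block_def by blast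
        have *: "max p u < min q v" "p < u \<and> q < v \<or> u < p \<and> v < q" using over uv(2) by auto
        have un: "{u..<v} \<union> ?J = {min p u..<max q v}" using * by auto
        have "block h ?A ({u..<v} \<union> ?J)" using block_Un[OF uv(1) J[OF h]] uv(2) by simp
        then have bf: "block f ?A {min p u..<max q v}" using to_f[of h] h un by auto
        have eq: "{min p u..<max q v} = ?A"
        proof (rule ccontr)
          assume "{min p u..<max q v} \<noteq> ?A"
          then have "P (max q v - min p u)"
            using bf pq * uv_sub unfolding P_def
            by (intro exI[of _ "min p u"] exI[of _ "max q v"]) auto
          then show False using l(2) pq * by fastforce
        qed
        have "min p u < max q v" "1 < 1 + n" using pq(2) n by simp_all
        then have ends: "min p u = 1" "max q v = 1 + n" using atLeastLessThan_inj[OF eq] by blast+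
        have "block h ?A ({u..<v} - ?J)"
          using block_Diff[OF uv(1) J[OF h]] uv(2) over by auto
        then have bd: "block f ?A ({u..<v} - ?J)" using to_f[of h] h by auto
        have "splits f ?A 1 (1 + n)"
          using *(2)
        proof
          assume c: "p < u \<and> q < v"
          then have "{u..<v} - ?J = {q..<v}" using * by auto
          then show ?thesis using bd pq c ends * unfolding splits_def by (intro exI[of _ q]) auto
        next
          assume c: "u < p \<and> v < q"
          then have "{u..<v} - ?J = {u..<p}" using * by auto
          then show ?thesis using bd pq c ends * unfolding splits_def by (intro exI[of _ p]) auto
        qed
        then show False using nosplit by blast
      qed
      show ?thesis
        using flip_gives_new_order[OF g(1) pq(1-3,5) inj no] g(2) by (intro exI[of _ g] conjI)
    qed
  qed
qed

section \<open>Schroeder trees and pattern-avoiding orders\<close>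

abbreviation forest_leaves :: "plane_tree list \<Rightarrow> nat" where
  "forest_leaves ts \<equiv> sum_list (map leaves ts)"

text \<open>\<open>realizes s a t f\<close>: the tree \<open>t\<close>, with its leaves numbered from \<open>a\<close> in plane order, describes
the order \<open>f\<close> on its leaves. Any two children of the root are compared in direction \<open>s\<close>, and
directions alternate along each branch. The alternation makes the tree unique: a child with the
direction of its parent could be merged with it.\<close>

fun realizes :: "bool \<Rightarrow> nat \<Rightarrow> plane_tree \<Rightarrow> (nat \<Rightarrow> int) \<Rightarrow> bool"
and realizes_forest :: "bool \<Rightarrow> nat \<Rightarrow> plane_tree list \<Rightarrow> (nat \<Rightarrow> int) \<Rightarrow> bool" where
  "realizes s a Leaf f \<longleftrightarrow> True"
| "realizes s a (Node ts) f \<longleftrightarrow> realizes_forest s a ts f"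
| "realizes_forest s a [] f \<longleftrightarrow> True"
| "realizes_forest s a (t # ts) f \<longleftrightarrow>
     realizes (\<not> s) a t f \<and>
     directed s f {a..<a + leaves t} {a + leaves t..<a + leaves t + forest_leaves ts} \<and>
     realizes_forest s (a + leaves t) ts f"

lemma split_range: "{a..<a + (m + n)} = {a..<a + m} \<union> {a + m..<a + m + n}" for a m n :: nat
  by auto

lemma realizes_cong:
  "same_order {a..<a + leaves t} f g \<Longrightarrow> realizes s a t f \<Longrightarrow> realizes s a t g"
  "same_order {a..<a + forest_leaves ts} f g \<Longrightarrow> realizes_forest s a ts f \<Longrightarrow> realizes_forest s a ts g"
proof (induction s a t f and s a ts f arbitrary: g and g rule: realizes_realizes_forest.induct)
  case (4 s a t ts f)
  have 1: "same_order {a..<a + leaves t} f g"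
    and 2: "same_order {a + leaves t..<a + leaves t + forest_leaves ts} f g"
    using 4(3) unfolding list.map sum_list.Cons split_range by (auto intro: same_order_mono)
  have "directed s g {a..<a + leaves t} {a + leaves t..<a + leaves t + forest_leaves ts}"
    using 4(3,4) by (intro same_order_directed[OF 4(3)]) auto
  then show ?case using 4(1)[OF 1] 4(2)[OF 2] 4(4) by simp
qed simp_all

lemma realizes_uminus:
  "realizes s a t f \<Longrightarrow> realizes (\<not> s) a t (\<lambda>x. - f x)"
  "realizes_forest s a ts f \<Longrightarrow> realizes_forest (\<not> s) a ts (\<lambda>x. - f x)"
  by (induction s a t f and s a ts f rule: realizes_realizes_forest.induct) auto

lemma realizes_avoids:
  "realizes s a t f \<Longrightarrow> avoids f {a..<a + leaves t}"
  "realizes_forest s a ts f \<Longrightarrow> avoids f {a..<a + forest_leaves ts}"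
proof (induction s a t f and s a ts f rule: realizes_realizes_forest.induct)
  case (4 s a t ts f)
  then show ?case
    using avoids_join[of s f a "a + leaves t" "a + leaves t + forest_leaves ts"]
    by (simp add: add.assoc)
qed (auto simp: avoids_def)

lemma directed_imp_same_order_Un:
  assumes "directed s f X Y" "directed s g X Y" "same_order X f g" "same_order Y f g"
  shows "same_order (X \<union> Y) f g"
  unfolding same_order_def
proof (intro ballI)
  fix x y assume "x \<in> X \<union> Y" "y \<in> X \<union> Y"
  then consider "x \<in> X" "y \<in> X" | "x \<in> X" "y \<in> Y" | "x \<in> Y" "y \<in> X" | "x \<in> Y" "y \<in> Y" by blast
  then show "f x < f y \<longleftrightarrow> g x < g y"
  proof cases
    case 2
    then show ?thesis using directedD(1)[OF assms(1)] directedD(1)[OF assms(2)] by blast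
  next
    case 3
    then show ?thesis using directedD(2)[OF assms(1)] directedD(2)[OF assms(2)] by blast
  qed (use assms(3,4) in \<open>auto simp: same_order_def\<close>)
qed

lemma realizes_determines_order:
  "realizes s a t f \<Longrightarrow> realizes s a t g \<Longrightarrow> same_order {a..<a + leaves t} f g"
  "realizes_forest s a ts f \<Longrightarrow> realizes_forest s a ts g \<Longrightarrow> same_order {a..<a + forest_leaves ts} f g"
proof (induction s a t f and s a ts f arbitrary: g and g rule: realizes_realizes_forest.induct)
  case (1 s a f)
  then show ?case by (auto simp: same_order_def less_Suc_eq_le)
next
  case (2 s a ts f)
  then show ?case by simp
next
  case (3 s a f)
  then show ?case by (simp add: same_order_def)
next
  case (4 s a t ts f)
  show ?case unfolding list.map sum_list.Cons split_range using 4(3,4) 4(1)[of g] 4(2)[of g]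
    by (intro directed_imp_same_order_Un[of s]) simp_all
qed

text \<open>The values realizing the tail of the forest are shifted by more than the largest distance between
the values of head and tail, so that the tail lies entirely on the required side.\<close>

lemma ex_realizes_forest:
  assumes "\<And>t s a. t \<in> set ts \<Longrightarrow> \<exists>f. inj_on f {a..<a + leaves t} \<and> realizes s a t f"
  shows "\<exists>f. inj_on f {a..<a + forest_leaves ts} \<and> realizes_forest s a ts f"
  using assms
proof (induction ts arbitrary: a)
  case (Cons t ts)
  let ?b = "a + leaves t" and ?c = "a + leaves t + forest_leaves ts"
  obtain f where f: "inj_on f {a..<?b}" "realizes (\<not> s) a t f"
    using Cons.prems[of t a "\<not> s"] by auto
  obtain g where g: "inj_on g {?b..<?c}" "realizes_forest s ?b ts g"
    using Cons.IH[of ?b] Cons.prems by auto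
  define D where "D = insert 0 ((\<lambda>(x, y). \<bar>f x - g y\<bar>) ` ({a..<?b} \<times> {?b..<?c}))"
  define M where "M = Max D + 1"
  have M: "\<bar>f x - g y\<bar> < M" if "x \<in> {a..<?b}" "y \<in> {?b..<?c}" for x y
  proof -
    have "finite D" by (simp add: D_def)
    moreover have "\<bar>f x - g y\<bar> \<in> D" unfolding D_def using that by force
    ultimately have "\<bar>f x - g y\<bar> \<le> Max D" by (rule Max_ge)
    then show ?thesis by (simp add: M_def)
  qed
  define h where "h x = (if x < ?b then f x else if s then g x + M else g x - M)" for x
  have dir: "directed s h {a..<?b} {?b..<?c}"
    unfolding directed_def
  proof (intro ballI)
    fix x y assume "x \<in> {a..<?b}" "y \<in> {?b..<?c}"
    then show "if s then h x < h y else h y < h x" using M[of x y] by (auto simp: h_def)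
  qed
  have oL: "same_order {a..<?b} f h" by (auto simp: same_order_def h_def)
  have oR: "same_order {?b..<?c} g h" by (auto simp: same_order_def h_def)
  have "inj_on h ({a..<?b} \<union> {?b..<?c})"
  proof (rule inj_onI)
    fix x y assume "x \<in> {a..<?b} \<union> {?b..<?c}" "y \<in> {a..<?b} \<union> {?b..<?c}" "h x = h y"
    then show "x = y"
      using directedD[OF dir, of x y] directedD[OF dir, of y x]
        same_order_inj_on[OF oL f(1)] same_order_inj_on[OF oR g(1)]
      by (auto dest: inj_onD)
  qed
  moreover have "realizes (\<not> s) a t h" using realizes_cong(1)[OF oL f(2)] .
  moreover have "realizes_forest s ?b ts h" using realizes_cong(2)[OF oR g(2)] .
  ultimately show ?case using dir unfolding list.map sum_list.Cons split_range by auto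
qed simp

lemma ex_realizes: "\<exists>f. inj_on f {a..<a + leaves t} \<and> realizes s a t f"
proof (induction t arbitrary: s a)
  case (Node ts)
  then show ?case using ex_realizes_forest[of ts a s] by simp
qed simp

lemma leaves_pos: "schroeder_tree t \<Longrightarrow> 0 < leaves t"
proof (induction t)
  case (Node ts)
  then obtain t ts' where "ts = t # ts'" by (cases ts) auto
  then show ?case using Node by auto
qed simp

lemma schroeder_Node_leaves: "schroeder_tree (Node ts) \<Longrightarrow> 2 \<le> forest_leaves ts"
proof -
  assume st: "schroeder_tree (Node ts)"
  then obtain t u us where ts: "ts = t # u # us" by (cases ts; cases "tl ts") auto
  then show ?thesis using leaves_pos[of t] leaves_pos[of u] st by simp
qed

lemma realizes_ends:
  assumes "realizes_forest s a ts f" "schroeder_tree (Node ts)"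
  shows "f a < f (a + forest_leaves ts - 1) \<longleftrightarrow> s"
proof -
  obtain t u us where ts: "ts = t # u # us"
    using assms(2) by (cases ts; cases "tl ts") auto
  have pos: "0 < leaves t" "0 < leaves u" using assms(2) ts leaves_pos by auto
  have "directed s f {a..<a + leaves t} {a + leaves t..<a + leaves t + forest_leaves (u # us)}"
    using assms(1) ts by simp
  then show ?thesis by (rule directedD) (use pos ts in auto)
qed

text \<open>If the first tree of the second forest had more leaves than \<open>t\<close>, it would be a node of direction
\<open>\<not> s\<close>, so its first and last leaf would be in direction \<open>\<not> s\<close>. But in the first forest these two
leaves belong to different trees, so they are in direction \<open>s\<close>.\<close>

lemma realizes_forest_head_le:
  assumes "realizes_forest s a (t # ts) f" "realizes_forest s a (t' # ts') f"
    and "schroeder_tree t" "schroeder_tree t'"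
    and "forest_leaves (t # ts) = forest_leaves (t' # ts')"
  shows "leaves t' \<le> leaves t"
proof (rule ccontr)
  assume "\<not> leaves t' \<le> leaves t"
  then have less: "leaves t < leaves t'" by simp
  have pos: "0 < leaves t" using leaves_pos assms(3) .
  then obtain us where us: "t' = Node us" using less by (cases t') auto
  have "f a < f (a + leaves t' - 1) \<longleftrightarrow> \<not> s"
    using realizes_ends[of "\<not> s" a us f] assms(2,4) us by simp
  moreover have "directed s f {a..<a + leaves t} {a + leaves t..<a + leaves t + forest_leaves ts}"
    using assms(1) by simp
  then have "f a < f (a + leaves t' - 1) \<longleftrightarrow> s"
    by (rule directedD) (use less pos assms(5) in auto)
  ultimately show False by blast
qed

text \<open>The direction of the root is determined by the first and the last leaf, and the sizes of the
children by \<open>realizes_forest_head_le\<close>.\<close>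

lemma realizes_tree_unique:
  "realizes s a t f \<Longrightarrow> realizes s' a t' f \<Longrightarrow> schroeder_tree t \<Longrightarrow> schroeder_tree t' \<Longrightarrow>
     leaves t = leaves t' \<Longrightarrow> t = t'"
  "realizes_forest s a ts f \<Longrightarrow> realizes_forest s a ts' f \<Longrightarrow>
     \<forall>t\<in>set ts. schroeder_tree t \<Longrightarrow> \<forall>t\<in>set ts'. schroeder_tree t \<Longrightarrow>
     forest_leaves ts = forest_leaves ts' \<Longrightarrow> ts = ts'"
proof (induction s a t f and s a ts f arbitrary: s' t' and ts' rule: realizes_realizes_forest.induct)
  case (1 s a f)
  show ?case
  proof (cases t')
    case (Node us)
    then show ?thesis using schroeder_Node_leaves[of us] 1(4,5) by simp
  qed simp
next
  case (2 s a ts f)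
  show ?case
  proof (cases t')
    case Leaf
    then show ?thesis using schroeder_Node_leaves[of ts] 2(4,6) by simp
  next
    case (Node us)
    have "s = s'"
      using realizes_ends[of s a ts f] realizes_ends[of s' a us f] 2(2-6) Node by simp
    then show ?thesis using 2(1)[of us] 2(2-6) Node by simp
  qed
next
  case (3 s a f)
  show ?case
  proof (cases ts')
    case (Cons t us)
    then show ?thesis using leaves_pos[of t] 3(4,5) by simp
  qed simp
next
  case (4 s a t ts f)
  have "ts' \<noteq> []" using 4(5,7) leaves_pos[of t] by auto
  then obtain t' us where ts': "ts' = t' # us" by (cases ts') auto
  have eq: "leaves t = leaves t'"
  proof (rule antisym)
    show "leaves t \<le> leaves t'"
      using 4(3-7) ts' by (intro realizes_forest_head_le[of s a t' us f t ts]) simp_all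
    show "leaves t' \<le> leaves t"
      using 4(3-7) ts' by (intro realizes_forest_head_le[of s a t ts f t' us]) simp_all
  qed
  have "t = t'" using 4(1)[of "\<not> s" t'] 4(3-7) ts' eq by simp
  moreover have "ts = us" using 4(2)[of us] 4(3-7) ts' eq by simp
  ultimately show ?case using ts' by simp
qed

lemma realizes_forest_append:
  "realizes_forest s a (ts @ us) f \<longleftrightarrow>
     realizes_forest s a ts f \<and> realizes_forest s (a + forest_leaves ts) us f \<and>
     directed s f {a..<a + forest_leaves ts}
       {a + forest_leaves ts..<a + forest_leaves ts + forest_leaves us}"
proof (induction ts arbitrary: a)
  case Nil
  then show ?case by (simp add: directed_def)
next
  case (Cons t ts)
  have Un: "directed s f (X \<union> Y) Z \<longleftrightarrow> directed s f X Z \<and> directed s f Y Z"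
    "directed s f X (Y \<union> Z) \<longleftrightarrow> directed s f X Y \<and> directed s f X Z" for X Y Z
    by (auto simp: directed_def)
  have 1: "{a + leaves t..<a + leaves t + forest_leaves (ts @ us)} =
      {a + leaves t..<a + leaves t + forest_leaves ts} \<union>
      {a + leaves t + forest_leaves ts..<a + leaves t + forest_leaves ts + forest_leaves us}"
    and 2: "{a..<a + leaves t + forest_leaves ts} =
      {a..<a + leaves t} \<union> {a + leaves t..<a + leaves t + forest_leaves ts}" by auto
  have 3: "a + forest_leaves (t # ts) = a + leaves t + forest_leaves ts" by simp
  show ?case unfolding append_Cons realizes_forest.simps Cons.IH 3 1 2 Un by blast
qed

text \<open>Whatever direction a tree has, it can become part of a node of direction \<open>s\<close>: it is a single
child if its direction is \<open>\<not> s\<close>, and it contributes its list of children if its direction is \<open>s\<close>.\<close>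

lemma realizes_as_forest:
  assumes "realizes r a t f" "schroeder_tree t"
  shows "\<exists>ts. ts \<noteq> [] \<and> realizes_forest s a ts f \<and> (\<forall>t\<in>set ts. schroeder_tree t) \<and>
    forest_leaves ts = leaves t"
proof (cases "\<exists>us. t = Node us \<and> r = s")
  case True
  then obtain us where us: "t = Node us" "r = s" by blast
  then have "us \<noteq> []" using assms(2) by auto
  then show ?thesis using assms us by auto
next
  case False
  then have "realizes (\<not> s) a t f" using assms by (cases t; cases r; cases s) auto
  then show ?thesis using assms(2) by (intro exI[of _ "[t]"]) (auto simp: directed_def)
qed

lemma avoids_imp_realizes:
  assumes "inj_on f {a..<b}" "avoids f {a..<b}" "a < b"
  shows "\<exists>s t. schroeder_tree t \<and> leaves t = b - a \<and> realizes s a t f"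
  using assms
proof (induction "b - a" arbitrary: a b rule: less_induct)
  case less
  show ?case
  proof (cases "Suc a < b")
    case False
    then have "b - a = 1" using less.prems by simp
    then show ?thesis by (intro exI[of _ True] exI[of _ Leaf]) simp
  next
    case True
    obtain c s where c: "a < c" "c < b" "directed s f {a..<c} {c..<b}"
      using avoids_imp_split[OF less.prems(1,2) True] by blast
    have sub: "{a..<c} \<subseteq> {a..<b}" "{c..<b} \<subseteq> {a..<b}" using c by auto
    obtain s1 t1 where 1: "schroeder_tree t1" "leaves t1 = c - a" "realizes s1 a t1 f"
      using less.hyps[of c a] less.prems c sub inj_on_subset avoids_mono by (metis diff_less_mono less_imp_le)
    obtain s2 t2 where 2: "schroeder_tree t2" "leaves t2 = b - c" "realizes s2 c t2 f"
      using less.hyps[of b c] less.prems c sub inj_on_subset avoids_mono by (metis diff_less_mono2 less_trans)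
    obtain ts1 where ts1: "ts1 \<noteq> []" "realizes_forest s a ts1 f" "\<forall>t\<in>set ts1. schroeder_tree t"
      "forest_leaves ts1 = c - a"
      using realizes_as_forest[OF 1(3,1), of s] 1(2) by auto
    obtain ts2 where ts2: "ts2 \<noteq> []" "realizes_forest s c ts2 f" "\<forall>t\<in>set ts2. schroeder_tree t"
      "forest_leaves ts2 = b - c"
      using realizes_as_forest[OF 2(3,1), of s] 2(2) by auto
    have "realizes s a (Node (ts1 @ ts2)) f"
      using ts1 ts2 c by (simp add: realizes_forest_append)
    moreover have "schroeder_tree (Node (ts1 @ ts2))"
      using ts1 ts2 by (cases ts1; cases ts2) auto
    moreover have "leaves (Node (ts1 @ ts2)) = b - a" using ts1 ts2 c by simp
    ultimately show ?thesis by blast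
  qed
qed

definition separable_interval_sets :: "nat \<Rightarrow> nat set set set" where
  "separable_interval_sets n =
     {interval_blocks f 1 (1 + n) | f. inj_on f {1..<1 + n} \<and> avoids f {1..<1 + n}}"

text \<open>The bijection sends a tree to the blocks of an order that realizes it with root direction
\<open>True\<close>. It is injective because the blocks determine the order up to reversal, and reversal
changes the direction of the root only. For the same reason orders with root direction \<open>False\<close>
contribute no further sets of blocks.\<close>

theorem card_separable_interval_sets:
  assumes "0 < n"
  shows "card (separable_interval_sets n) = little_schroeder n"
proof -
  define T where "T = {t. schroeder_tree t \<and> leaves t = n}"
  define F where "F t = (SOME f. inj_on f {1..<1 + n} \<and> realizes True 1 t f)" for t
  have F: "inj_on (F t) {1..<1 + n}" "realizes True 1 t (F t)" if "t \<in> T" for t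
  proof -
    have "\<exists>f. inj_on f {1..<1 + n} \<and> realizes True 1 t f"
      using ex_realizes[of 1 t True] that unfolding T_def by auto
    from someI_ex[OF this] show "inj_on (F t) {1..<1 + n}" "realizes True 1 t (F t)"
      unfolding F_def by blast+
  qed
  have av: "avoids (F t) {1..<1 + n}" if "t \<in> T" for t
    using realizes_avoids(1)[OF F(2)[OF that]] that by (simp add: T_def)
  have "bij_betw (\<lambda>t. interval_blocks (F t) 1 (1 + n)) T (separable_interval_sets n)"
    unfolding bij_betw_def
  proof (intro conjI inj_onI set_eqI iffI)
    fix t u assume tu: "t \<in> T" "u \<in> T"
      and eq: "interval_blocks (F t) 1 (1 + n) = interval_blocks (F u) 1 (1 + n)"
    have "\<exists>s. realizes s 1 u (F t)"
      using avoids_imp_unique_up_to_reversal[OF F(1)[OF tu(1)] F(1)[OF tu(2)] av[OF tu(1)] eq]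
    proof
      assume "same_order {1..<1 + n} (F t) (F u)"
      from same_order_sym[OF this] show ?thesis
        using realizes_cong(1)[of 1 u "F u" "F t" True] F(2)[OF tu(2)] tu(2) by (auto simp: T_def)
    next
      assume "same_order {1..<1 + n} (F t) (\<lambda>x. - F u x)"
      from same_order_sym[OF this] show ?thesis
        using realizes_cong(1)[of 1 u "\<lambda>x. - F u x" "F t" False]
          realizes_uminus(1)[OF F(2)[OF tu(2)]] tu(2) by (auto simp: T_def)
    qed
    then show "t = u" using realizes_tree_unique(1)[OF F(2)[OF tu(1)]] tu by (auto simp: T_def)
  next
    fix Q assume "Q \<in> (\<lambda>t. interval_blocks (F t) 1 (1 + n)) ` T"
    then show "Q \<in> separable_interval_sets n"
      using F(1) av unfolding separable_interval_sets_def by blast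
  next
    fix Q assume "Q \<in> separable_interval_sets n"
    then obtain f where f: "inj_on f {1..<1 + n}" "avoids f {1..<1 + n}"
      and Q: "Q = interval_blocks f 1 (1 + n)"
      unfolding separable_interval_sets_def by blast
    obtain s t where t: "schroeder_tree t" "leaves t = n" "realizes s 1 t f"
      using avoids_imp_realizes[OF f] assms by auto
    then have T: "t \<in> T" by (simp add: T_def)
    have "interval_blocks (F t) 1 (1 + n) = Q"
    proof (cases s)
      case True
      then have "same_order {1..<1 + n} (F t) f"
        using realizes_determines_order(1)[OF F(2)[OF T]] t by simp
      then show ?thesis using same_order_interval_blocks Q by blast
    next
      case False
      then have "same_order {1..<1 + n} (F t) (\<lambda>x. - f x)"
        using realizes_determines_order(1)[OF F(2)[OF T], of "\<lambda>x. - f x"]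
          realizes_uminus(1)[OF t(3)] t by simp
      from same_order_interval_blocks[OF this] show ?thesis using Q by simp
    qed
    then show "Q \<in> (\<lambda>t. interval_blocks (F t) 1 (1 + n)) ` T" using T by blast
  qed
  then show ?thesis unfolding little_schroeder_def T_def[symmetric] by (rule bij_betw_same_card[symmetric])
qed

section \<open>The first little Schroeder numbers\<close>

definition trees :: "nat \<Rightarrow> plane_tree set" where
  "trees n = {t. schroeder_tree t \<and> leaves t = n}"

definition forests :: "nat \<Rightarrow> plane_tree list set" where
  "forests n = {ts. (\<forall>t\<in>set ts. schroeder_tree t) \<and> forest_leaves ts = n}"

lemma trees_0 [simp]: "trees 0 = {}"
  using leaves_pos by (auto simp: trees_def)

lemma forests_0 [simp]: "forests 0 = {[]}"
proof -
  have "ts = []" if "ts \<in> forests 0" for ts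
    using that leaves_pos[of "hd ts"] by (cases ts) (auto simp: forests_def)
  then show ?thesis by (auto simp: forests_def)
qed

lemma trees_1 [simp]: "trees (Suc 0) = {Leaf}"
proof -
  have "t = Leaf" if "t \<in> trees (Suc 0)" for t
    using that schroeder_Node_leaves by (cases t) (fastforce simp: trees_def)+
  then show ?thesis by (auto simp: trees_def)
qed

lemma forests_Suc:
  "forests (Suc n) = (\<Union>k\<in>{1..Suc n}. (\<lambda>(t, ts). t # ts) ` (trees k \<times> forests (Suc n - k)))"
proof (intro set_eqI iffI)
  fix ts assume ts: "ts \<in> forests (Suc n)"
  then obtain t us where "ts = t # us" by (cases ts) (auto simp: forests_def)
  then show "ts \<in> (\<Union>k\<in>{1..Suc n}. (\<lambda>(t, ts). t # ts) ` (trees k \<times> forests (Suc n - k)))"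
    using ts leaves_pos[of t]
    by (intro UN_I[of "leaves t"]) (auto simp: forests_def trees_def)
next
  fix ts assume "ts \<in> (\<Union>k\<in>{1..Suc n}. (\<lambda>(t, ts). t # ts) ` (trees k \<times> forests (Suc n - k)))"
  then show "ts \<in> forests (Suc n)" by (auto simp: forests_def trees_def)
qed

text \<open>A Schroeder tree is a root with a first child and a nonempty forest of further children; the
latter is nonempty as soon as the first child does not use up all leaves. Together with
\<open>forests_Suc\<close> this computes the numbers of trees and forests by a joint recursion.\<close>

lemma trees_eq_forests:
  assumes "2 \<le> n"
  shows "trees n = Node ` (\<Union>k\<in>{1..<n}. (\<lambda>(t, ts). t # ts) ` (trees k \<times> forests (n - k)))" (is "_ = ?R")
proof (intro set_eqI iffI)
  fix t assume t: "t \<in> trees n"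
  then obtain ts where ts: "t = Node ts" using assms by (cases t) (auto simp: trees_def)
  then obtain u v us where us: "ts = u # v # us"
    using t by (cases ts; cases "tl ts") (auto simp: trees_def)
  have "0 < leaves u" "0 < leaves v" using t ts us leaves_pos by (auto simp: trees_def)
  then have "ts \<in> (\<Union>k\<in>{1..<n}. (\<lambda>(t, ts). t # ts) ` (trees k \<times> forests (n - k)))"
    using t ts us by (intro UN_I[of "leaves u"]) (auto simp: trees_def forests_def image_iff)
  then show "t \<in> ?R" using ts by blast
next
  fix t assume "t \<in> ?R"
  then obtain u us k where *: "t = Node (u # us)" "k \<in> {1..<n}" "u \<in> trees k" "us \<in> forests (n - k)"
    by auto
  then have "us \<noteq> []" by (auto simp: forests_def)
  then show "t \<in> trees n" using * by (cases us) (auto simp: trees_def forests_def)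
qed

lemma card_cons_Union:
  assumes "finite K" "\<And>k. k \<in> K \<Longrightarrow> finite (trees k)" "\<And>k. k \<in> K \<Longrightarrow> finite (forests (n - k))"
  shows "finite (\<Union>k\<in>K. (\<lambda>(t, ts). t # ts) ` (trees k \<times> forests (n - k)))"
    and "card (\<Union>k\<in>K. (\<lambda>(t, ts). t # ts) ` (trees k \<times> forests (n - k))) =
      (\<Sum>k\<in>K. card (trees k) * card (forests (n - k)))"
proof -
  have fin: "finite ((\<lambda>(t, ts). t # ts) ` (trees k \<times> forests (n - k)))" if "k \<in> K" for k
    using assms(2,3)[OF that] by simp
  then show "finite (\<Union>k\<in>K. (\<lambda>(t, ts). t # ts) ` (trees k \<times> forests (n - k)))"
    using assms(1) by blast
  have "card (\<Union>k\<in>K. (\<lambda>(t, ts). t # ts) ` (trees k \<times> forests (n - k))) =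
      (\<Sum>k\<in>K. card ((\<lambda>(t, ts). t # ts) ` (trees k \<times> forests (n - k))))"
    by (rule card_UN_disjoint) (use assms(1) fin in \<open>auto simp: trees_def\<close>)
  also have "\<dots> = (\<Sum>k\<in>K. card (trees k) * card (forests (n - k)))"
    by (intro sum.cong refl) (auto simp: card_image inj_on_def card_cartesian_product)
  finally show "card (\<Union>k\<in>K. (\<lambda>(t, ts). t # ts) ` (trees k \<times> forests (n - k))) =
      (\<Sum>k\<in>K. card (trees k) * card (forests (n - k)))" .
qed

lemma finite_trees_forests: "finite (trees n) \<and> finite (forests n)"
proof (induction n rule: less_induct)
  case (less n)
  have t: "finite (trees n)"
  proof (cases "2 \<le> n")
    case True
    then show ?thesis unfolding trees_eq_forests[OF True]
      by (intro finite_imageI card_cons_Union(1)) (use less in auto)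
  next
    case False
    then have "n = 0 \<or> n = Suc 0" by linarith
    then show ?thesis by auto
  qed
  have "finite (forests n)"
  proof (cases n)
    case (Suc m)
    have tr: "finite (trees k)" if "k \<in> {1..Suc m}" for k
      using t less[of k] that Suc by (cases "k = n") auto
    show ?thesis unfolding Suc forests_Suc
      by (intro card_cons_Union(1)) (use less Suc tr in auto)
  qed simp
  then show ?case using t by blast
qed

lemma card_trees_rec:
  assumes "2 \<le> n"
  shows "card (trees n) = (\<Sum>k\<in>{1..<n}. card (trees k) * card (forests (n - k)))"
  unfolding trees_eq_forests[OF assms]
  by (subst card_image) (auto simp: inj_on_def card_cons_Union(2) finite_trees_forests)

lemma card_forests_rec:
  "card (forests (Suc n)) = (\<Sum>k\<in>{1..Suc n}. card (trees k) * card (forests (Suc n - k)))"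
  unfolding forests_Suc by (rule card_cons_Union(2)) (auto simp: finite_trees_forests)

lemma little_schroeder_values:
  "little_schroeder 2 = 1" "little_schroeder 3 = 3" "little_schroeder 4 = 11"
proof -
  have f1: "card (forests (Suc 0)) = 1" by (simp add: card_forests_rec)
  have t2: "card (trees 2) = 1" using f1 by (subst card_trees_rec) (simp_all add: numeral_eq_Suc)
  have f2: "card (forests 2) = 2" using f1 t2 card_forests_rec[of 1] by (simp add: numeral_eq_Suc)
  have t3: "card (trees 3) = 3" using f1 f2 t2 by (subst card_trees_rec) (simp_all add: numeral_eq_Suc)
  have f3: "card (forests 3) = 6" using f1 f2 t2 t3 card_forests_rec[of 2] by (simp add: numeral_eq_Suc)
  have t4: "card (trees 4) = 11" using f1 f2 f3 t2 t3 by (subst card_trees_rec) (simp_all add: numeral_eq_Suc)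
  show "little_schroeder 2 = 1" "little_schroeder 3 = 3" "little_schroeder 4 = 11"
    using t2 t3 t4 by (simp_all add: little_schroeder_def trees_def)
qed

section \<open>Words and their position maps\<close>

text \<open>Integer values, because reversing an order is expressed by negation.\<close>

definition pos :: "nat list \<Rightarrow> nat \<Rightarrow> int" where
  "pos \<sigma> x = int (inv_into {1..length \<sigma>} (letter \<sigma>) x)"

lemma perm_word_iff:
  "perm_word \<sigma> \<longleftrightarrow> distinct \<sigma> \<and> set \<sigma> = {1..length \<sigma>}"
  unfolding perm_word_def permutations_of_set_def by auto

lemma letter_bij:
  assumes "perm_word \<sigma>" shows "bij_betw (letter \<sigma>) {1..length \<sigma>} {1..length \<sigma>}"
proof -
  have "bij_betw ((!) \<sigma> \<circ> (\<lambda>i. i - 1)) {1..length \<sigma>} (set \<sigma>)"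
  proof (rule bij_betw_trans)
    show "bij_betw (\<lambda>i. i - 1) {1..length \<sigma>} {..<length \<sigma>}"
      by (rule bij_betw_byWitness[of _ Suc]) auto
    show "bij_betw ((!) \<sigma>) {..<length \<sigma>} (set \<sigma>)"
      using assms by (intro bij_betw_nth) (auto simp: perm_word_iff)
  qed
  then show ?thesis using assms by (simp add: perm_word_iff letter_def[abs_def] comp_def)
qed

lemma pos_letter:
  assumes "perm_word \<sigma>" "i \<in> {1..length \<sigma>}"
  shows "pos \<sigma> (letter \<sigma> i) = int i" "letter \<sigma> i \<in> {1..length \<sigma>}"
  using bij_betw_inv_into_left[OF letter_bij[OF assms(1)] assms(2)]
    bij_betw_apply[OF letter_bij[OF assms(1)] assms(2)]
  by (simp_all add: pos_def)

lemma pos_cases: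
  assumes "perm_word \<sigma>" "x \<in> {1..length \<sigma>}"
  obtains i where "i \<in> {1..length \<sigma>}" "x = letter \<sigma> i" "pos \<sigma> x = int i"
proof -
  have "x \<in> letter \<sigma> ` {1..length \<sigma>}"
    using letter_bij[OF assms(1)] assms(2) unfolding bij_betw_def by simp
  then obtain i where i: "i \<in> {1..length \<sigma>}" "x = letter \<sigma> i" by blast
  then show thesis using that pos_letter(1)[OF assms(1) i(1)] by simp
qed

lemma pos_inj: "perm_word \<sigma> \<Longrightarrow> inj_on (pos \<sigma>) {1..<1 + length \<sigma>}"
proof (rule inj_onI)
  fix x y assume p: "perm_word \<sigma>" and "x \<in> {1..<1 + length \<sigma>}" "y \<in> {1..<1 + length \<sigma>}" "pos \<sigma> x = pos \<sigma> y"
  then show "x = y" using pos_cases[OF p, of x] pos_cases[OF p, of y]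
    by (metis atLeastLessThanSuc_atLeastAtMost of_nat_eq_iff plus_1_eq_Suc)
qed

text \<open>An interval of the word is a set of values that occupies consecutive places. Conversely, the
places of a block have no gap, since the value in a gap would stand between two members of the
block. This translates the interval poset into the language of orders.\<close>

lemma interval_poset_eq_interval_blocks:
  assumes "perm_word \<sigma>"
  shows "interval_poset \<sigma> = interval_blocks (pos \<sigma>) 1 (1 + length \<sigma>)"
proof (intro set_eqI iffI)
  let ?n = "length \<sigma>"
  fix I assume "I \<in> interval_poset \<sigma>"
  then obtain i j h where I: "I = {j..j + h}" and i: "1 \<le> i" "i + h \<le> ?n"
    and im: "letter \<sigma> ` {i..i + h} = {j..j + h}"
    unfolding interval_poset_def by blast
  have "{j..j + h} \<subseteq> {1..?n}" unfolding im[symmetric] using i pos_letter(2)[OF assms] by auto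
  then have j: "1 \<le> j" "j + h \<le> ?n" by auto
  have J: "I = {j..<Suc (j + h)}" using I by auto
  have "block (pos \<sigma>) {1..<1 + ?n} I"
    unfolding block_def
  proof (intro conjI ballI)
    show "I \<subseteq> {1..<1 + ?n}" using I j by auto
  next
    fix z assume z: "z \<in> {1..<1 + ?n} - I"
    then obtain m where m: "m \<in> {1..?n}" "z = letter \<sigma> m" "pos \<sigma> z = int m"
      using pos_cases[OF assms, of z] by auto
    have "m \<notin> {i..i + h}" using m(2) z im I by blast
    moreover have "pos \<sigma> u \<in> {int i..int (i + h)}" if u: "u \<in> I" for u
    proof -
      obtain k where "k \<in> {i..i + h}" "u = letter \<sigma> k" using u im I by blast
      then show ?thesis using pos_letter(1)[OF assms, of k] i by auto
    qed
    ultimately show "(\<forall>u\<in>I. pos \<sigma> u < pos \<sigma> z) \<or> (\<forall>u\<in>I. pos \<sigma> z < pos \<sigma> u)"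
      using m(3) by (cases "m < i") fastforce+
  qed
  then show "I \<in> interval_blocks (pos \<sigma>) 1 (1 + ?n)"
    unfolding J interval_blocks_def using j by (intro CollectI exI[of _ j] exI[of _ "Suc (j + h)"]) auto
next
  let ?n = "length \<sigma>"
  fix I assume "I \<in> interval_blocks (pos \<sigma>) 1 (1 + ?n)"
  then obtain x y where I: "I = {x..<y}" and xy: "1 \<le> x" "x < y" "y \<le> 1 + ?n"
    and bl: "block (pos \<sigma>) {1..<1 + ?n} I"
    unfolding interval_blocks_def by blast
  \<comment> \<open>The places of the block; they turn out to be consecutive.\<close>
  define S where "S = {i \<in> {1..?n}. letter \<sigma> i \<in> I}"
  have Isub: "I \<subseteq> {1..?n}" using I xy by auto
  have im: "letter \<sigma> ` S = I"
  proof (intro set_eqI iffI)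
    fix u assume u: "u \<in> I"
    then obtain i where "i \<in> {1..?n}" "u = letter \<sigma> i" using pos_cases[OF assms, of u] Isub by blast
    then show "u \<in> letter \<sigma> ` S" using u by (auto simp: S_def)
  qed (auto simp: S_def)
  have "inj_on (letter \<sigma>) S"
    by (rule inj_on_subset[OF bij_betw_imp_inj_on[OF letter_bij[OF assms]]]) (auto simp: S_def)
  then have card: "card S = y - x" using card_image[of "letter \<sigma>" S] im I by simp
  have S: "finite S" "S \<noteq> {}"
  proof -
    show "finite S" by (simp add: S_def)
    show "S \<noteq> {}" using card xy by (metis card.empty zero_less_diff less_irrefl)
  qed
  define i where "i = Min S"
  have iS: "i \<in> S" "Max S \<in> S" using S by (simp_all add: i_def)
  have "S = {i..Max S}"
  proof (intro set_eqI iffI)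
    fix k assume "k \<in> S" then show "k \<in> {i..Max S}" using S by (simp add: i_def)
  next
    fix k assume k: "k \<in> {i..Max S}"
    then have kn: "k \<in> {1..?n}" using iS by (auto simp: S_def)
    show "k \<in> S"
    proof (rule ccontr)
      assume nk: "k \<notin> S"
      then have "letter \<sigma> k \<in> {1..<1 + ?n} - I" using kn pos_letter(2)[OF assms kn] by (auto simp: S_def)
      then have "(\<forall>u\<in>I. pos \<sigma> u < pos \<sigma> (letter \<sigma> k)) \<or> (\<forall>u\<in>I. pos \<sigma> (letter \<sigma> k) < pos \<sigma> u)"
        using bl unfolding block_def by blast
      moreover have "letter \<sigma> i \<in> I" "letter \<sigma> (Max S) \<in> I" "i \<in> {1..?n}" "Max S \<in> {1..?n}"
        using iS by (auto simp: S_def)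
      ultimately have "int i < int k \<and> int (Max S) < int k \<or> int k < int i \<and> int k < int (Max S)"
        using pos_letter(1)[OF assms, of i] pos_letter(1)[OF assms, of k]
          pos_letter(1)[OF assms, of "Max S"] kn by metis
      then show False using k by auto
    qed
  qed
  then have "card S = Suc (Max S) - i" by (metis card_atLeastAtMost)
  moreover have "i \<le> Max S" using S iS by simp
  ultimately have MS: "Max S = i + (y - x - 1)" using card xy by linarith
  have "I = {x..x + (y - x - 1)}" using I xy by auto
  moreover have "letter \<sigma> ` {i..i + (y - x - 1)} = I" using im \<open>S = {i..Max S}\<close> MS by simp
  moreover have "1 \<le> i" "i + (y - x - 1) \<le> ?n" using iS MS by (auto simp: S_def)
  ultimately show "I \<in> interval_poset \<sigma>" unfolding interval_poset_def by blast
qed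

text \<open>The place of a value is its rank, so a word is determined by the order in which its letters stand.\<close>

lemma pos_eq_rank:
  assumes "perm_word \<sigma>" "x \<in> {1..length \<sigma>}"
  shows "pos \<sigma> x = int (card {u \<in> {1..length \<sigma>}. \<not> pos \<sigma> x < pos \<sigma> u})"
proof -
  obtain i where i: "i \<in> {1..length \<sigma>}" "x = letter \<sigma> i" "pos \<sigma> x = int i"
    using pos_cases[OF assms] .
  have "{u \<in> {1..length \<sigma>}. \<not> pos \<sigma> x < pos \<sigma> u} = letter \<sigma> ` {1..i}"
  proof (intro set_eqI iffI)
    fix u assume u: "u \<in> {u \<in> {1..length \<sigma>}. \<not> pos \<sigma> x < pos \<sigma> u}"
    then obtain k where "k \<in> {1..length \<sigma>}" "u = letter \<sigma> k" "pos \<sigma> u = int k"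
      using pos_cases[OF assms(1), of u] by auto
    then show "u \<in> letter \<sigma> ` {1..i}" using u i by auto
  next
    fix u assume "u \<in> letter \<sigma> ` {1..i}"
    then show "u \<in> {u \<in> {1..length \<sigma>}. \<not> pos \<sigma> x < pos \<sigma> u}"
      using i pos_letter[OF assms(1)] by fastforce
  qed
  moreover have "inj_on (letter \<sigma>) {1..i}"
    by (rule inj_on_subset[OF bij_betw_imp_inj_on[OF letter_bij[OF assms(1)]]]) (use i(1) in auto)
  ultimately show ?thesis using i(3) by (simp add: card_image)
qed

lemma word_eqI:
  assumes "perm_word \<sigma>" "perm_word \<tau>" "length \<sigma> = length \<tau>"
    and "same_order {1..<1 + length \<sigma>} (pos \<sigma>) (pos \<tau>)"
  shows "\<sigma> = \<tau>"
proof (rule nth_equalityI)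
  show "length \<sigma> = length \<tau>" by fact
next
  fix k assume k: "k < length \<sigma>"
  let ?x = "letter \<sigma> (Suc k)"
  have x: "?x \<in> {1..length \<sigma>}" "pos \<sigma> ?x = int (Suc k)" using pos_letter[OF assms(1), of "Suc k"] k by auto
  have "pos \<sigma> ?x < pos \<sigma> u \<longleftrightarrow> pos \<tau> ?x < pos \<tau> u" if "u \<in> {1..length \<sigma>}" for u
  proof -
    have "?x \<in> {1..<1 + length \<sigma>}" "u \<in> {1..<1 + length \<sigma>}" using x(1) that by auto
    then show ?thesis using assms(4) unfolding same_order_def by blast
  qed
  then have "{u \<in> {1..length \<sigma>}. \<not> pos \<sigma> ?x < pos \<sigma> u} = {u \<in> {1..length \<sigma>}. \<not> pos \<tau> ?x < pos \<tau> u}"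
    by blast
  then have "pos \<tau> ?x = int (Suc k)"
    using pos_eq_rank[OF assms(1) x(1)] pos_eq_rank[OF assms(2), of ?x] x assms(3) by simp
  moreover obtain i where "?x = letter \<tau> i" "pos \<tau> ?x = int i"
    using pos_cases[OF assms(2), of ?x] x assms(3) by metis
  ultimately have "?x = letter \<tau> (Suc k)" by (metis of_nat_eq_iff)
  then show "\<sigma> ! k = \<tau> ! k" by (simp add: letter_def)
qed

lemma perm_word_rev: "perm_word (rev \<sigma>) \<longleftrightarrow> perm_word \<sigma>"
  by (simp add: perm_word_iff)

lemma pos_rev:
  assumes "perm_word \<sigma>" "x \<in> {1..length \<sigma>}"
  shows "pos (rev \<sigma>) x = 1 + int (length \<sigma>) - pos \<sigma> x"
proof -
  obtain i where i: "i \<in> {1..length \<sigma>}" "x = letter \<sigma> i" "pos \<sigma> x = int i"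
    using pos_cases[OF assms] .
  have "letter (rev \<sigma>) (1 + length \<sigma> - i) = x"
    using i by (auto simp: letter_def rev_nth Suc_diff_le)
  moreover have "1 + length \<sigma> - i \<in> {1..length (rev \<sigma>)}" using i(1) by auto
  ultimately have "pos (rev \<sigma>) x = int (1 + length \<sigma> - i)"
    using pos_letter(1)[of "rev \<sigma>" "1 + length \<sigma> - i"] assms(1) by (simp add: perm_word_rev)
  then show ?thesis using i by auto
qed

lemma same_order_pos_rev:
  assumes "perm_word \<sigma>"
  shows "same_order {1..<1 + length \<sigma>} (pos (rev \<sigma>)) (\<lambda>x. - pos \<sigma> x)"
  using pos_rev[OF assms] by (auto simp: same_order_def)

lemma interval_poset_rev:
  assumes "perm_word \<sigma>"
  shows "interval_poset (rev \<sigma>) = interval_poset \<sigma>"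
  using same_order_interval_blocks[OF same_order_pos_rev[OF assms]] assms
  by (simp add: interval_poset_eq_interval_blocks perm_word_rev)

text \<open>The word is obtained by sorting the values by \<open>f\<close>.\<close>

lemma ex_perm_word:
  assumes "inj_on f {1..<1 + n}"
  shows "\<exists>\<sigma>. perm_word \<sigma> \<and> length \<sigma> = n \<and> same_order {1..<1 + n} (pos \<sigma>) f"
proof -
  define \<sigma> where "\<sigma> = sort_key f [1..<1 + n]"
  have len: "length \<sigma> = n" by (simp add: \<sigma>_def)
  have set: "set \<sigma> = {1..<1 + n}" unfolding \<sigma>_def set_sort set_upt ..
  have "distinct \<sigma>" by (simp add: \<sigma>_def)
  then have pw: "perm_word \<sigma>" unfolding perm_word_iff set len by auto
  have "sorted (map f \<sigma>)" by (simp add: \<sigma>_def)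
  moreover have "distinct (map f \<sigma>)"
    using assms pw set by (simp add: distinct_map perm_word_iff)
  ultimately have mono: "sorted_wrt (<) (map f \<sigma>)" by (simp add: strict_sorted_iff)
  have less: "f (letter \<sigma> i) < f (letter \<sigma> j)" if "i < j" "1 \<le> i" "j \<le> n" for i j
    using sorted_wrt_nth_less[OF mono, of "i - 1" "j - 1"] that len by (simp add: letter_def)
  have "same_order {1..<1 + n} (pos \<sigma>) f"
    unfolding same_order_def
  proof (intro ballI)
    fix x y assume "x \<in> {1..<1 + n}" "y \<in> {1..<1 + n}"
    then have xy: "x \<in> {1..length \<sigma>}" "y \<in> {1..length \<sigma>}" using len by auto
    obtain i where i: "i \<in> {1..length \<sigma>}" "x = letter \<sigma> i" "pos \<sigma> x = int i"
      using pos_cases[OF pw xy(1)] .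
    obtain j where j: "j \<in> {1..length \<sigma>}" "y = letter \<sigma> j" "pos \<sigma> y = int j"
      using pos_cases[OF pw xy(2)] .
    show "pos \<sigma> x < pos \<sigma> y \<longleftrightarrow> f x < f y"
      using less[of i j] less[of j i] i j len by (cases i j rule: linorder_cases) auto
  qed
  then show ?thesis using pw len by blast
qed

lemma singleton_in_interval_poset:
  assumes "perm_word \<sigma>"
  shows "{x} \<in> interval_poset \<sigma> \<longleftrightarrow> x \<in> {1..length \<sigma>}"
proof
  assume "{x} \<in> interval_poset \<sigma>"
  then show "x \<in> {1..length \<sigma>}"
  proof -
    obtain a b where ab: "{x} = {a..<b}" "1 \<le> a" "b \<le> 1 + length \<sigma>"
      using \<open>{x} \<in> interval_poset \<sigma>\<close>
      unfolding interval_poset_eq_interval_blocks[OF assms] interval_blocks_def by blast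
    have "x \<in> {a..<b}" unfolding ab(1)[symmetric] by simp
    then show ?thesis using ab by simp
  qed
next
  assume x: "x \<in> {1..length \<sigma>}"
  then obtain i where "i \<in> {1..length \<sigma>}" "x = letter \<sigma> i" using pos_cases[OF assms x] by blast
  then show "{x} \<in> interval_poset \<sigma>" unfolding interval_poset_def
    by (intro CollectI exI[of _ i] exI[of _ x] exI[of _ 0]) auto
qed

text \<open>The size of a generator is visible in the poset as the number of singletons.\<close>

lemma interval_poset_length:
  assumes "perm_word \<sigma>" "perm_word \<tau>" "interval_poset \<sigma> = interval_poset \<tau>"
  shows "length \<sigma> = length \<tau>"
proof -
  have "{1..length \<sigma>} = {1..length \<tau>}"
    using singleton_in_interval_poset[OF assms(1)] singleton_in_interval_poset[OF assms(2)] assms(3)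
    by blast
  then show ?thesis by (metis card_atLeastAtMost diff_Suc_1)
qed

lemma card_minimal_elements:
  assumes "perm_word \<sigma>"
  shows "card (minimal_elements (interval_poset \<sigma>)) = length \<sigma>"
proof -
  have "minimal_elements (interval_poset \<sigma>) = (\<lambda>x. {x}) ` {1..length \<sigma>}"
  proof (intro set_eqI iffI)
    fix I assume I: "I \<in> minimal_elements (interval_poset \<sigma>)"
    then have "I \<in> interval_blocks (pos \<sigma>) 1 (1 + length \<sigma>)"
      unfolding minimal_elements_def interval_poset_eq_interval_blocks[OF assms] by simp
    then obtain x where x: "x \<in> I" "x \<in> {1..length \<sigma>}" unfolding interval_blocks_def by fastforce
    then have "{x} \<in> interval_poset \<sigma>" using singleton_in_interval_poset[OF assms] by simp
    then have "I = {x}" using I x unfolding minimal_elements_def by blast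
    then show "I \<in> (\<lambda>x. {x}) ` {1..length \<sigma>}" using x by blast
  next
    fix I assume "I \<in> (\<lambda>x. {x}) ` {1..length \<sigma>}"
    then obtain x where x: "I = {x}" "x \<in> {1..length \<sigma>}" by blast
    have "{} \<notin> interval_poset \<sigma>" unfolding interval_poset_def by auto
    then show "I \<in> minimal_elements (interval_poset \<sigma>)"
      using x singleton_in_interval_poset[OF assms] unfolding minimal_elements_def
      by (auto simp: psubset_eq subset_singleton_iff)
  qed
  then show ?thesis by (simp add: card_image)
qed

lemma subseq_Cons_iff:
  "subseq (x # xs) ys \<longleftrightarrow> (\<exists>i < length ys. ys ! i = x \<and> subseq xs (drop (Suc i) ys))"
proof
  assume "subseq (x # xs) ys"
  then obtain us vs where "ys = us @ x # vs" "subseq xs vs"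
    by (auto dest: list_emb_ConsD)
  then show "\<exists>i < length ys. ys ! i = x \<and> subseq xs (drop (Suc i) ys)"
    by (intro exI[of _ "length us"]) auto
next
  assume "\<exists>i < length ys. ys ! i = x \<and> subseq xs (drop (Suc i) ys)"
  then obtain i where i: "i < length ys" "ys ! i = x" "subseq xs (drop (Suc i) ys)" by blast
  then have "ys = take i ys @ x # drop (Suc i) ys" using id_take_nth_drop by blast
  moreover have "subseq (x # xs) (x # drop (Suc i) ys)" using i by simp
  ultimately show "subseq (x # xs) ys" by (metis list_emb_append2)
qed

text \<open>A form of \<open>subseq_Cons_iff\<close> that can be iterated, with indices that refer to the whole word.\<close>

lemma subseq_Cons_drop_iff:
  "subseq (x # xs) (drop m ys) \<longleftrightarrow>
     (\<exists>i. m \<le> i \<and> i < length ys \<and> ys ! i = x \<and> subseq xs (drop (Suc i) ys))"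
proof
  assume "subseq (x # xs) (drop m ys)"
  then obtain i where i: "i < length ys - m" "drop m ys ! i = x" "subseq xs (drop (Suc i) (drop m ys))"
    unfolding subseq_Cons_iff by auto
  then show "\<exists>i. m \<le> i \<and> i < length ys \<and> ys ! i = x \<and> subseq xs (drop (Suc i) ys)"
    by (intro exI[of _ "m + i"]) (auto simp: add_ac)
next
  assume "\<exists>i. m \<le> i \<and> i < length ys \<and> ys ! i = x \<and> subseq xs (drop (Suc i) ys)"
  then obtain i where i: "m \<le> i" "i < length ys" "ys ! i = x" "subseq xs (drop (Suc i) ys)"
    by blast
  then have "i - m < length (drop m ys)" "drop m ys ! (i - m) = x"
    "subseq xs (drop (Suc (i - m)) (drop m ys))" by auto
  then show "subseq (x # xs) (drop m ys)" unfolding subseq_Cons_iff by blast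
qed

lemma subseq_4_iff:
  "subseq [w, x, y, z] ys \<longleftrightarrow> (\<exists>i j k l. i < j \<and> j < k \<and> k < l \<and> l < length ys \<and>
     ys ! i = w \<and> ys ! j = x \<and> ys ! k = y \<and> ys ! l = z)" (is "_ \<longleftrightarrow> ?r")
proof -
  have "subseq [w, x, y, z] (drop 0 ys) \<longleftrightarrow> (\<exists>i. 0 \<le> i \<and> i < length ys \<and> ys ! i = w \<and>
      (\<exists>j. Suc i \<le> j \<and> j < length ys \<and> ys ! j = x \<and>
      (\<exists>k. Suc j \<le> k \<and> k < length ys \<and> ys ! k = y \<and>
      (\<exists>l. Suc k \<le> l \<and> l < length ys \<and> ys ! l = z \<and> True))))"
    unfolding subseq_Cons_drop_iff by simp
  also have "\<dots> \<longleftrightarrow> ?r"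
  proof (intro iffI; elim exE conjE)
    fix i j k l
    assume "Suc i \<le> j" "Suc j \<le> k" "Suc k \<le> l" "l < length ys"
      "ys ! i = w" "ys ! j = x" "ys ! k = y" "ys ! l = z"
    then show ?r by (intro exI[of _ i] exI[of _ j] exI[of _ k] exI[of _ l]) simp
  next
    fix i j k l
    assume *: "i < j" "j < k" "k < l" "l < length ys"
      "ys ! i = w" "ys ! j = x" "ys ! k = y" "ys ! l = z"
    have "\<exists>l. Suc k \<le> l \<and> l < length ys \<and> ys ! l = z \<and> True"
      using * by (intro exI[of _ l]) simp
    then have "\<exists>k. Suc j \<le> k \<and> k < length ys \<and> ys ! k = y \<and>
      (\<exists>l. Suc k \<le> l \<and> l < length ys \<and> ys ! l = z \<and> True)"
      using * by (intro exI[of _ k]) simp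
    then have "\<exists>j. Suc i \<le> j \<and> j < length ys \<and> ys ! j = x \<and>
      (\<exists>k. Suc j \<le> k \<and> k < length ys \<and> ys ! k = y \<and>
      (\<exists>l. Suc k \<le> l \<and> l < length ys \<and> ys ! l = z \<and> True))"
      using * by (intro exI[of _ j]) simp
    then show "\<exists>i. 0 \<le> i \<and> i < length ys \<and> ys ! i = w \<and>
      (\<exists>j. Suc i \<le> j \<and> j < length ys \<and> ys ! j = x \<and>
      (\<exists>k. Suc j \<le> k \<and> k < length ys \<and> ys ! k = y \<and>
      (\<exists>l. Suc k \<le> l \<and> l < length ys \<and> ys ! l = z \<and> True)))"
      using * by (intro exI[of _ i]) simp
  qed
  finally show ?thesis by simp
qed

lemma order_isomorphic_patterns:
  "order_isomorphic xs [2, 4, 1, 3] \<longleftrightarrow> (\<exists>w x y z. xs = [w, x, y, z] \<and> y < w \<and> w < z \<and> z < x)"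
  "order_isomorphic xs [3, 1, 4, 2] \<longleftrightarrow> (\<exists>w x y z. xs = [w, x, y, z] \<and> x < z \<and> z < w \<and> w < y)"
proof -
  have len: "length xs = 4 \<longleftrightarrow> (\<exists>w x y z. xs = [w, x, y, z])"
    by (auto simp: numeral_eq_Suc length_Suc_conv)
  have "order_isomorphic [w, x, y, z] [2, 4, 1, 3] \<longleftrightarrow> y < w \<and> w < z \<and> z < x"
    "order_isomorphic [w, x, y, z] [3, 1, 4, 2] \<longleftrightarrow> x < z \<and> z < w \<and> w < y" for w x y z
    unfolding order_isomorphic_def by (auto simp: numeral_eq_Suc All_less_Suc)
  moreover have "length xs = 4" if "order_isomorphic xs [2, 4, 1, 3] \<or> order_isomorphic xs [3, 1, 4, 2]"
    using that by (auto simp: order_isomorphic_def)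
  ultimately show "order_isomorphic xs [2, 4, 1, 3] \<longleftrightarrow> (\<exists>w x y z. xs = [w, x, y, z] \<and> y < w \<and> w < z \<and> z < x)"
    "order_isomorphic xs [3, 1, 4, 2] \<longleftrightarrow> (\<exists>w x y z. xs = [w, x, y, z] \<and> x < z \<and> z < w \<and> w < y)"
    using len by metis+
qed

lemma contains_pattern_iff:
  "contains_pattern \<sigma> [2, 4, 1, 3] \<longleftrightarrow> (\<exists>i j k l. i < j \<and> j < k \<and> k < l \<and> l < length \<sigma> \<and>
     \<sigma> ! k < \<sigma> ! i \<and> \<sigma> ! i < \<sigma> ! l \<and> \<sigma> ! l < \<sigma> ! j)"
  "contains_pattern \<sigma> [3, 1, 4, 2] \<longleftrightarrow> (\<exists>i j k l. i < j \<and> j < k \<and> k < l \<and> l < length \<sigma> \<and>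
     \<sigma> ! j < \<sigma> ! l \<and> \<sigma> ! l < \<sigma> ! i \<and> \<sigma> ! i < \<sigma> ! k)"
proof -
  have "contains_pattern \<sigma> [2, 4, 1, 3] \<longleftrightarrow>
      (\<exists>w x y z. subseq [w, x, y, z] \<sigma> \<and> y < w \<and> w < z \<and> z < x)"
    "contains_pattern \<sigma> [3, 1, 4, 2] \<longleftrightarrow>
      (\<exists>w x y z. subseq [w, x, y, z] \<sigma> \<and> x < z \<and> z < w \<and> w < y)"
    unfolding contains_pattern_def order_isomorphic_patterns by blast+
  then show "contains_pattern \<sigma> [2, 4, 1, 3] \<longleftrightarrow> (\<exists>i j k l. i < j \<and> j < k \<and> k < l \<and> l < length \<sigma> \<and>
     \<sigma> ! k < \<sigma> ! i \<and> \<sigma> ! i < \<sigma> ! l \<and> \<sigma> ! l < \<sigma> ! j)"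
    "contains_pattern \<sigma> [3, 1, 4, 2] \<longleftrightarrow> (\<exists>i j k l. i < j \<and> j < k \<and> k < l \<and> l < length \<sigma> \<and>
     \<sigma> ! j < \<sigma> ! l \<and> \<sigma> ! l < \<sigma> ! i \<and> \<sigma> ! i < \<sigma> ! k)"
    unfolding subseq_4_iff by (blast, blast)
qed

lemma separable_iff_avoids_letter:
  "separable \<sigma> \<longleftrightarrow> perm_word \<sigma> \<and> avoids (\<lambda>i. int (letter \<sigma> i)) {1..<1 + length \<sigma>}"
proof -
  have "contains_pattern \<sigma> [2, 4, 1, 3] \<or> contains_pattern \<sigma> [3, 1, 4, 2] \<longleftrightarrow>
    (\<exists>i j k l. i < j \<and> j < k \<and> k < l \<and> l < length \<sigma> \<and>
      (\<sigma> ! k < \<sigma> ! i \<and> \<sigma> ! i < \<sigma> ! l \<and> \<sigma> ! l < \<sigma> ! j \<or>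
       \<sigma> ! j < \<sigma> ! l \<and> \<sigma> ! l < \<sigma> ! i \<and> \<sigma> ! i < \<sigma> ! k))"
    unfolding contains_pattern_iff by blast
  also have "\<dots> \<longleftrightarrow> \<not> avoids (\<lambda>i. int (letter \<sigma> i)) {1..<1 + length \<sigma>}" (is "?l \<longleftrightarrow> ?r")
  proof
    assume ?l
    then obtain i j k l where *: "i < j" "j < k" "k < l" "l < length \<sigma>"
      "\<sigma> ! k < \<sigma> ! i \<and> \<sigma> ! i < \<sigma> ! l \<and> \<sigma> ! l < \<sigma> ! j \<or>
       \<sigma> ! j < \<sigma> ! l \<and> \<sigma> ! l < \<sigma> ! i \<and> \<sigma> ! i < \<sigma> ! k" by blast
    then show ?r unfolding avoids_def not_not letter_def
      by (intro bexI[of _ "Suc i"] bexI[of _ "Suc j"] bexI[of _ "Suc k"] bexI[of _ "Suc l"]) auto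
  next
    assume ?r
    then obtain i j k l where *: "1 \<le> i" "i < j" "j < k" "k < l" "l < 1 + length \<sigma>"
      "letter \<sigma> k < letter \<sigma> i \<and> letter \<sigma> i < letter \<sigma> l \<and> letter \<sigma> l < letter \<sigma> j \<or>
       letter \<sigma> j < letter \<sigma> l \<and> letter \<sigma> l < letter \<sigma> i \<and> letter \<sigma> i < letter \<sigma> k"
      unfolding avoids_def by auto
    then show ?l unfolding letter_def
      by (intro exI[of _ "i - 1"] exI[of _ "j - 1"] exI[of _ "k - 1"] exI[of _ "l - 1"]) auto
  qed
  finally show ?thesis unfolding separable_def by blast
qed

lemma letter_inverse_word:
  assumes "i \<in> {1..length \<sigma>}"
  shows "int (letter (inverse_word \<sigma>) i) = pos \<sigma> i"
  using assms by (auto simp: letter_def inverse_word_def pos_def simp del: upt_Suc)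

lemma length_inverse_word [simp]: "length (inverse_word \<sigma>) = length \<sigma>"
  by (simp add: inverse_word_def del: upt_Suc)

lemma perm_word_inverse_word:
  assumes "perm_word \<sigma>" shows "perm_word (inverse_word \<sigma>)"
proof -
  have "bij_betw (inv_into {1..length \<sigma>} (letter \<sigma>)) {1..length \<sigma>} {1..length \<sigma>}"
    using letter_bij[OF assms] by (rule bij_betw_inv_into)
  moreover have "set [1..<Suc (length \<sigma>)] = {1..length \<sigma>}" by auto
  ultimately show ?thesis
    unfolding perm_word_iff inverse_word_def distinct_map bij_betw_def by (simp del: upt_Suc)
qed

text \<open>Passing to the inverse function turns an occurrence of one pattern into an occurrence of the other:
if the values \<open>i < j < k < l\<close> have places that form 2413, then the letters at these places, read in
the order of the places, are \<open>k\<close>, \<open>i\<close>, \<open>l\<close>, \<open>j\<close> and form 3142, and conversely.\<close>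

lemma avoids_pos_iff_avoids_letter:
  assumes p: "perm_word \<sigma>"
  shows "avoids (pos \<sigma>) {1..<1 + length \<sigma>} \<longleftrightarrow> avoids (\<lambda>i. int (letter \<sigma> i)) {1..<1 + length \<sigma>}"
    (is "avoids _ ?A \<longleftrightarrow> _")
proof -
  have inv: "avoids f ?A" if f: "avoids g ?A" and fg: "\<And>x. x \<in> ?A \<Longrightarrow> \<exists>i\<in>?A. f x = int i \<and> g i = int x"
    for f g :: "nat \<Rightarrow> int"
    unfolding avoids_def
  proof (intro notI, elim bexE conjE)
    fix i j k l assume A: "i \<in> ?A" "j \<in> ?A" "k \<in> ?A" "l \<in> ?A" and ord: "i < j" "j < k" "k < l"
      and pat: "f k < f i \<and> f i < f l \<and> f l < f j \<or> f j < f l \<and> f l < f i \<and> f i < f k"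
    obtain i' j' k' l' where "i' \<in> ?A" "f i = int i'" "g i' = int i" "j' \<in> ?A" "f j = int j'" "g j' = int j"
      "k' \<in> ?A" "f k = int k'" "g k' = int k" "l' \<in> ?A" "f l = int l'" "g l' = int l"
      using fg A by metis
    then show False using pat ord avoidsD(2)[OF f, of k' i' l' j'] avoidsD(1)[OF f, of j' l' i' k']
      by auto
  qed
  have 1: "\<exists>i\<in>?A. pos \<sigma> x = int i \<and> int (letter \<sigma> i) = int x" if "x \<in> ?A" for x
    using pos_cases[OF p, of x] that by force
  have 2: "\<exists>x\<in>?A. int (letter \<sigma> i) = int x \<and> pos \<sigma> x = int i" if "i \<in> ?A" for i
    using pos_letter[OF p, of i] that by auto
  show ?thesis by (intro iffI; erule inv) (fact 1 2)+
qed

lemma separable_iff_avoids_pos: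
  assumes "perm_word \<sigma>"
  shows "separable \<sigma> \<longleftrightarrow> avoids (pos \<sigma>) {1..<1 + length \<sigma>}"
  using assms avoids_pos_iff_avoids_letter[OF assms] separable_iff_avoids_letter[of \<sigma>] by blast

lemma separable_inverse_word:
  assumes "perm_word \<sigma>"
  shows "separable (inverse_word \<sigma>) \<longleftrightarrow> separable \<sigma>"
proof -
  have "same_order {1..<1 + length \<sigma>} (\<lambda>i. int (letter (inverse_word \<sigma>) i)) (pos \<sigma>)"
    using letter_inverse_word by (auto simp: same_order_def)
  then have "avoids (\<lambda>i. int (letter (inverse_word \<sigma>) i)) {1..<1 + length \<sigma>} \<longleftrightarrow> avoids (pos \<sigma>) {1..<1 + length \<sigma>}"
    using same_order_avoids same_order_sym by blast
  then show ?thesis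
    using perm_word_inverse_word[OF assms] separable_iff_avoids_pos[OF assms]
    by (simp add: separable_iff_avoids_letter)
qed

section \<open>Generators of an interval poset\<close>

text \<open>An occurrence of a pattern of size 4 in a word of size at most 4 is the whole word.\<close>

lemma not_separable_short:
  assumes "perm_word \<sigma>" "\<not> separable \<sigma>" "length \<sigma> \<le> 4"
  shows "\<sigma> = [2, 4, 1, 3] \<or> \<sigma> = [3, 1, 4, 2]"
proof -
  obtain i j k l where ord: "i < j" "j < k" "k < l" "l < length \<sigma>"
    and pat: "\<sigma> ! k < \<sigma> ! i \<and> \<sigma> ! i < \<sigma> ! l \<and> \<sigma> ! l < \<sigma> ! j \<or>
      \<sigma> ! j < \<sigma> ! l \<and> \<sigma> ! l < \<sigma> ! i \<and> \<sigma> ! i < \<sigma> ! k"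
    using assms(1,2) unfolding separable_def contains_pattern_iff by blast
  then have idx: "i = 0" "j = 1" "k = 2" "l = 3" "length \<sigma> = 4" using assms(3) by linarith+
  have bound: "1 \<le> \<sigma> ! m \<and> \<sigma> ! m \<le> 4" if "m < 4" for m
    using assms(1) that idx(5) unfolding perm_word_iff by (metis atLeastAtMost_iff nth_mem)
  have "\<sigma> = [\<sigma> ! 0, \<sigma> ! 1, \<sigma> ! 2, \<sigma> ! 3]"
    using idx(5) by (intro nth_equalityI) (auto simp: numeral_eq_Suc less_Suc_eq)
  moreover have "\<sigma> ! 0 = 2 \<and> \<sigma> ! 1 = 4 \<and> \<sigma> ! 2 = 1 \<and> \<sigma> ! 3 = 3 \<or>
      \<sigma> ! 0 = 3 \<and> \<sigma> ! 1 = 1 \<and> \<sigma> ! 2 = 4 \<and> \<sigma> ! 3 = 2"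
    using pat bound[of 0] bound[of 1] bound[of 2] bound[of 3] unfolding idx by linarith
  ultimately show ?thesis by metis
qed

lemma patterns_not_separable: "\<not> separable [2, 4, 1, 3]" "\<not> separable [3, 1, 4, 2]"
proof -
  have "contains_pattern [2, 4, 1, 3] [2, 4, 1, 3]"
    unfolding contains_pattern_iff
    by (rule exI[of _ 0], rule exI[of _ 1], rule exI[of _ 2], rule exI[of _ 3]) simp
  moreover have "contains_pattern [3, 1, 4, 2] [3, 1, 4, 2]"
    unfolding contains_pattern_iff
    by (rule exI[of _ 0], rule exI[of _ 1], rule exI[of _ 2], rule exI[of _ 3]) simp
  ultimately show "\<not> separable [2, 4, 1, 3]" "\<not> separable [3, 1, 4, 2]"
    by (simp_all add: separable_def)
qed

lemma perm_word_patterns: "perm_word [2, 4, 1, 3]" "perm_word [3, 1, 4, 2]"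
  by (auto simp: perm_word_iff)

lemma rev_neq:
  assumes "perm_word \<sigma>" "2 \<le> length \<sigma>"
  shows "rev \<sigma> \<noteq> \<sigma>"
proof
  assume "rev \<sigma> = \<sigma>"
  moreover have pos: "0 < length \<sigma>" using assms(2) by linarith
  ultimately have "\<sigma> ! (length \<sigma> - 1) = \<sigma> ! 0" using rev_nth[OF pos] by simp
  moreover have "distinct \<sigma>" using assms(1) by (simp add: perm_word_iff)
  ultimately have "length \<sigma> - 1 = 0"
    using nth_eq_iff_index_eq[of \<sigma> "length \<sigma> - 1" 0] pos by simp
  then show False using assms(2) by linarith
qed

lemma generators_iff:
  assumes "perm_word \<sigma>"
  shows "\<tau> \<in> generators (interval_poset \<sigma>) \<longleftrightarrow>
    perm_word \<tau> \<and> length \<tau> = length \<sigma> \<and>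
    interval_blocks (pos \<tau>) 1 (1 + length \<sigma>) = interval_blocks (pos \<sigma>) 1 (1 + length \<sigma>)"
proof (cases "perm_word \<tau> \<and> length \<tau> = length \<sigma>")
  case True
  then show ?thesis
    using interval_poset_eq_interval_blocks[OF assms] interval_poset_eq_interval_blocks[of \<tau>]
    by (simp add: generators_def)
next
  case False
  then show ?thesis using interval_poset_length[of \<tau> \<sigma>] assms by (auto simp: generators_def)
qed

lemma self_rev_generators:
  assumes "perm_word \<sigma>"
  shows "\<sigma> \<in> generators (interval_poset \<sigma>)" "rev \<sigma> \<in> generators (interval_poset \<sigma>)"
  using assms by (simp_all add: generators_def perm_word_rev interval_poset_rev)

lemma word_eq_rev_if_opposite:
  assumes "perm_word \<sigma>" "perm_word \<tau>" "length \<sigma> = length \<tau>"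
    and "same_order {1..<1 + length \<sigma>} (pos \<sigma>) (\<lambda>x. - pos \<tau> x)"
  shows "\<sigma> = rev \<tau>"
proof (rule word_eqI)
  have "same_order {1..<1 + length \<sigma>} (\<lambda>x. - pos \<tau> x) (pos (rev \<tau>))"
    using same_order_sym[OF same_order_pos_rev[OF assms(2)]] assms(3) by simp
  then show "same_order {1..<1 + length \<sigma>} (pos \<sigma>) (pos (rev \<tau>))"
    using assms(4) same_order_trans by blast
qed (use assms in \<open>simp_all add: perm_word_rev\<close>)

lemma generators_separable:
  assumes "separable \<sigma>"
  shows "generators (interval_poset \<sigma>) = {\<sigma>, rev \<sigma>}"
proof
  have p: "perm_word \<sigma>" using assms by (simp add: separable_def)
  then show "{\<sigma>, rev \<sigma>} \<subseteq> generators (interval_poset \<sigma>)" using self_rev_generators by blast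
  show "generators (interval_poset \<sigma>) \<subseteq> {\<sigma>, rev \<sigma>}"
  proof
    fix \<tau> assume "\<tau> \<in> generators (interval_poset \<sigma>)"
    then have t: "perm_word \<tau>" "length \<tau> = length \<sigma>"
      and eq: "interval_blocks (pos \<tau>) 1 (1 + length \<sigma>) = interval_blocks (pos \<sigma>) 1 (1 + length \<sigma>)"
      using generators_iff[OF p] by blast+
    have "avoids (pos \<sigma>) {1..<1 + length \<sigma>}" using assms separable_iff_avoids_pos[OF p] by blast
    moreover have "inj_on (pos \<tau>) {1..<1 + length \<sigma>}" using pos_inj[OF t(1)] t(2) by simp
    ultimately have "same_order {1..<1 + length \<sigma>} (pos \<sigma>) (pos \<tau>) \<or>
        same_order {1..<1 + length \<sigma>} (pos \<sigma>) (\<lambda>x. - pos \<tau> x)"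
      using pos_inj[OF p] eq by (intro avoids_imp_unique_up_to_reversal) auto
    then have "\<sigma> = \<tau> \<or> \<sigma> = rev \<tau>"
      using word_eqI[OF p t(1)] word_eq_rev_if_opposite[OF p t(1)] t(2) by metis
    then show "\<tau> \<in> {\<sigma>, rev \<sigma>}" by auto
  qed
qed

lemma third_generator:
  assumes p: "perm_word \<sigma>" and "\<not> separable \<sigma>" "5 \<le> length \<sigma>"
  shows "\<exists>\<tau> \<in> generators (interval_poset \<sigma>). \<tau> \<noteq> \<sigma> \<and> \<tau> \<noteq> rev \<sigma>"
proof -
  let ?A = "{1..<1 + length \<sigma>}"
  obtain g where g: "inj_on g ?A" and
    eq: "interval_blocks (pos \<sigma>) 1 (1 + length \<sigma>) = interval_blocks g 1 (1 + length \<sigma>)" and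
    new: "\<not> same_order ?A (pos \<sigma>) g" "\<not> same_order ?A (pos \<sigma>) (\<lambda>x. - g x)"
    using not_avoids_imp_other_order[OF pos_inj[OF p] _ assms(3)] assms(2)
      separable_iff_avoids_pos[OF p] by blast
  obtain \<tau> where t: "perm_word \<tau>" "length \<tau> = length \<sigma>" "same_order ?A (pos \<tau>) g"
    using ex_perm_word[OF g] by blast
  have "\<tau> \<in> generators (interval_poset \<sigma>)"
    unfolding generators_iff[OF p] using t same_order_interval_blocks[OF t(3)] eq by simp
  moreover have "\<tau> \<noteq> \<sigma>" using t(3) new(1) by blast
  moreover have "\<tau> \<noteq> rev \<sigma>"
  proof
    assume "\<tau> = rev \<sigma>"
    then have "same_order ?A (pos (rev \<sigma>)) g" using t(3) by simp
    then have "same_order ?A (\<lambda>x. - pos \<sigma> x) g"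
      using same_order_trans[OF same_order_sym[OF same_order_pos_rev[OF p]]] by blast
    from same_order_uminus[OF this] show False using new(2) by simp
  qed
  ultimately show ?thesis by blast
qed

text \<open>A generator of size 4 that is not separable is one of the two patterns, which are reversals of each
other. A separable generator \<open>\<tau>\<close> would have \<open>\<sigma>\<close> among its own generators, and these are only
\<open>\<tau>\<close> and its reversal.\<close>

lemma generators_patterns:
  assumes "\<sigma> = [2, 4, 1, 3] \<or> \<sigma> = [3, 1, 4, 2]"
  shows "generators (interval_poset \<sigma>) = {\<sigma>, rev \<sigma>}"
proof
  have p: "perm_word \<sigma>" using assms perm_word_patterns by blast
  then show "{\<sigma>, rev \<sigma>} \<subseteq> generators (interval_poset \<sigma>)" using self_rev_generators by blast
  show "generators (interval_poset \<sigma>) \<subseteq> {\<sigma>, rev \<sigma>}"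
  proof
    fix \<tau> assume t: "\<tau> \<in> generators (interval_poset \<sigma>)"
    then have pt: "perm_word \<tau>" "length \<tau> = length \<sigma>" using generators_iff[OF p] by blast+
    show "\<tau> \<in> {\<sigma>, rev \<sigma>}"
    proof (cases "separable \<tau>")
      case True
      have "\<sigma> \<in> generators (interval_poset \<tau>)" using t p by (auto simp: generators_def)
      then show ?thesis using generators_separable[OF True] by auto
    next
      case False
      then show ?thesis using not_separable_short[OF pt(1) False] pt(2) assms by auto
    qed
  qed
qed

theorem two_generators_iff:
  assumes "perm_word \<sigma>"
  shows "card (generators (interval_poset \<sigma>)) = 2 \<longleftrightarrow>
    separable \<sigma> \<and> 2 \<le> length \<sigma> \<or> \<sigma> = [2, 4, 1, 3] \<or> \<sigma> = [3, 1, 4, 2]" (is "?l \<longleftrightarrow> ?r")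
proof
  assume ?r
  then have gen: "generators (interval_poset \<sigma>) = {\<sigma>, rev \<sigma>}" and "2 \<le> length \<sigma>"
    using generators_separable generators_patterns by auto
  then show ?l using rev_neq[OF assms] by auto
next
  assume card: ?l
  show ?r
  proof (rule ccontr)
    assume neg: "\<not> ?r"
    show False
    proof (cases "separable \<sigma>")
      case True
      then have "length \<sigma> \<le> 1" using neg by linarith
      then have "rev \<sigma> = \<sigma>" by (cases \<sigma>) auto
      then show False using generators_separable[OF True] card by simp
    next
      case False
      then have len: "5 \<le> length \<sigma>" using not_separable_short[OF assms False] neg by linarith
      obtain \<tau> where "\<tau> \<in> generators (interval_poset \<sigma>)" "\<tau> \<noteq> \<sigma>" "\<tau> \<noteq> rev \<sigma>"
        using third_generator[OF assms False len] by blast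
      then have "{\<sigma>, rev \<sigma>, \<tau>} \<subseteq> generators (interval_poset \<sigma>)" "card {\<sigma>, rev \<sigma>, \<tau>} = 3"
        using self_rev_generators[OF assms] rev_neq[OF assms] len by auto
      moreover have "finite (generators (interval_poset \<sigma>))" using card by (intro card_ge_0_finite) simp
      ultimately have "3 \<le> card (generators (interval_poset \<sigma>))" by (metis card_mono)
      then show False using card by simp
    qed
  qed
qed

text \<open>The two words are the permutations of size 4 that are not separable, and both properties are
preserved by inversion.\<close>

lemma inverse_word_patterns:
  assumes "perm_word \<sigma>"
  shows "inverse_word \<sigma> = [2, 4, 1, 3] \<or> inverse_word \<sigma> = [3, 1, 4, 2] \<longleftrightarrow>
    \<sigma> = [2, 4, 1, 3] \<or> \<sigma> = [3, 1, 4, 2]"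
proof -
  have "\<omega> = [2, 4, 1, 3] \<or> \<omega> = [3, 1, 4, 2] \<longleftrightarrow> length \<omega> = 4 \<and> \<not> separable \<omega>"
    if "perm_word \<omega>" for \<omega>
    using not_separable_short[OF that] patterns_not_separable by auto
  then show ?thesis
    using separable_inverse_word[OF assms] perm_word_inverse_word[OF assms] assms
      length_inverse_word[of \<sigma>] by metis
qed

section \<open>Counting posets with two generators\<close>

lemma separable_posets_eq:
  "{interval_poset \<sigma> | \<sigma>. separable \<sigma> \<and> length \<sigma> = n} = separable_interval_sets n"
proof (intro set_eqI iffI)
  fix Q assume "Q \<in> {interval_poset \<sigma> | \<sigma>. separable \<sigma> \<and> length \<sigma> = n}"
  then obtain \<sigma> where s: "separable \<sigma>" "length \<sigma> = n" "Q = interval_poset \<sigma>" by blast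
  then have p: "perm_word \<sigma>" by (simp add: separable_def)
  show "Q \<in> separable_interval_sets n"
    using s pos_inj[OF p] separable_iff_avoids_pos[OF p] interval_poset_eq_interval_blocks[OF p]
    unfolding separable_interval_sets_def by blast
next
  fix Q assume "Q \<in> separable_interval_sets n"
  then obtain f where f: "inj_on f {1..<1 + n}" "avoids f {1..<1 + n}" "Q = interval_blocks f 1 (1 + n)"
    unfolding separable_interval_sets_def by blast
  obtain \<sigma> where s: "perm_word \<sigma>" "length \<sigma> = n" "same_order {1..<1 + n} (pos \<sigma>) f"
    using ex_perm_word[OF f(1)] by blast
  have "avoids (pos \<sigma>) {1..<1 + n}" using same_order_avoids[OF same_order_sym[OF s(3)] f(2)] .
  then have "separable \<sigma>" using separable_iff_avoids_pos[OF s(1)] s(2) by simp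
  moreover have "Q = interval_poset \<sigma>"
    using interval_poset_eq_interval_blocks[OF s(1)] same_order_interval_blocks[OF s(3)] f(3) s(2) by simp
  ultimately show "Q \<in> {interval_poset \<sigma> | \<sigma>. separable \<sigma> \<and> length \<sigma> = n}" using s(2) by blast
qed

lemma two_generator_posets_eq:
  "{Q. is_interval_poset Q \<and> card (minimal_elements Q) = n \<and> card (generators Q) = 2} =
     (if 2 \<le> n then separable_interval_sets n else {}) \<union>
     (if n = 4 then {interval_poset [2, 4, 1, 3]} else {})" (is "?l = ?r")
proof -
  define R where "R \<sigma> \<longleftrightarrow> separable \<sigma> \<and> 2 \<le> length \<sigma> \<or> \<sigma> = [2, 4, 1, 3] \<or> \<sigma> = [3, 1, 4, 2]" for \<sigma>
  have R: "perm_word \<sigma>" if "R \<sigma>" for \<sigma>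
    using that perm_word_patterns unfolding R_def separable_def by metis
  have two: "card (generators (interval_poset \<sigma>)) = 2 \<longleftrightarrow> R \<sigma>" if "perm_word \<sigma>" for \<sigma>
    unfolding R_def by (rule two_generators_iff[OF that])
  have rev: "interval_poset [3, 1, 4, 2] = interval_poset [2, 4, 1, 3]"
    using interval_poset_rev[OF perm_word_patterns(1)] by simp
  have l: "Q \<in> ?l \<longleftrightarrow> (\<exists>\<sigma>. R \<sigma> \<and> length \<sigma> = n \<and> Q = interval_poset \<sigma>)" for Q
    unfolding is_interval_poset_def using R two card_minimal_elements by auto
  have r: "Q \<in> ?r \<longleftrightarrow> (\<exists>\<sigma>. R \<sigma> \<and> length \<sigma> = n \<and> Q = interval_poset \<sigma>)" for Q
  proof
    assume "Q \<in> ?r"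
    then consider "2 \<le> n" "Q \<in> separable_interval_sets n" | "n = 4" "Q = interval_poset [2, 4, 1, 3]"
      by (auto split: if_splits)
    then show "\<exists>\<sigma>. R \<sigma> \<and> length \<sigma> = n \<and> Q = interval_poset \<sigma>"
    proof cases
      case 1
      then show ?thesis unfolding separable_posets_eq[symmetric] R_def by blast
    next
      case 2
      then show ?thesis unfolding R_def by (intro exI[of _ "[2, 4, 1, 3]"]) simp
    qed
  next
    assume "\<exists>\<sigma>. R \<sigma> \<and> length \<sigma> = n \<and> Q = interval_poset \<sigma>"
    then obtain \<sigma> where s: "R \<sigma>" "length \<sigma> = n" "Q = interval_poset \<sigma>" by blast
    from s(1) consider "separable \<sigma>" "2 \<le> length \<sigma>" | "\<sigma> = [2, 4, 1, 3] \<or> \<sigma> = [3, 1, 4, 2]"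
      unfolding R_def by argo
    then show "Q \<in> ?r"
    proof cases
      case 1
      then have "Q \<in> separable_interval_sets n"
        using s(2,3) unfolding separable_posets_eq[symmetric] by blast
      then show ?thesis using 1 s(2) by simp
    next
      case 2
      then show ?thesis using s(2,3) rev by auto
    qed
  qed
  show ?thesis using l r by blast
qed

text \<open>The generators of this poset are 2413 and 3142, and neither of them is separable.\<close>

lemma simple_poset_not_separable: "interval_poset [2, 4, 1, 3] \<notin> separable_interval_sets 4"
proof
  assume "interval_poset [2, 4, 1, 3] \<in> separable_interval_sets 4"
  then obtain \<sigma> where s: "separable \<sigma>" "interval_poset [2, 4, 1, 3] = interval_poset \<sigma>"
    unfolding separable_posets_eq[symmetric] by blast
  then have "\<sigma> \<in> generators (interval_poset [2, 4, 1, 3])" by (simp add: generators_def separable_def)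
  then show False using generators_patterns[of "[2, 4, 1, 3]"] patterns_not_separable s(1) by auto
qed

theorem num_two_generator_posets_eq:
  "num_two_generator_posets n =
     (if 2 \<le> n then little_schroeder n else 0) + (if n = 4 then 1 else 0)"
proof (cases "n = 4")
  case True
  have "finite (separable_interval_sets 4)"
    using card_separable_interval_sets[of 4] little_schroeder_values(3)
    by (intro card_ge_0_finite) simp
  then show ?thesis
    using simple_poset_not_separable card_separable_interval_sets[of 4] True
    unfolding num_two_generator_posets_def two_generator_posets_eq by simp
next
  case False
  then show ?thesis
    unfolding num_two_generator_posets_def two_generator_posets_eq
    by (simp add: card_separable_interval_sets)
qed

theorem theorem18:
  "(\<forall>\<sigma>. perm_word \<sigma> \<longrightarrow>
      (card (generators (interval_poset \<sigma>)) = 2 \<longleftrightarrow>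
         separable (inverse_word \<sigma>) \<and> 2 \<le> length (inverse_word \<sigma>) \<or>
         inverse_word \<sigma> = [2, 4, 1, 3] \<or> inverse_word \<sigma> = [3, 1, 4, 2]) \<and>
      (card (generators (interval_poset \<sigma>)) = 2 \<longleftrightarrow>
         separable \<sigma> \<and> 2 \<le> length \<sigma> \<or> \<sigma> = [2, 4, 1, 3] \<or> \<sigma> = [3, 1, 4, 2])) \<and>
   num_two_generator_posets 1 = 0 \<and>
   num_two_generator_posets 2 = little_schroeder 2 \<and> little_schroeder 2 = 1 \<and>
   num_two_generator_posets 3 = little_schroeder 3 \<and> little_schroeder 3 = 3 \<and>
   num_two_generator_posets 4 = little_schroeder 4 + 1 \<and> little_schroeder 4 + 1 = 12 \<and>
   (\<forall>n \<ge> 5. num_two_generator_posets n = little_schroeder n)"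
proof (intro conjI allI impI)
  fix \<sigma> assume p: "perm_word \<sigma>"
  show "card (generators (interval_poset \<sigma>)) = 2 \<longleftrightarrow>
      separable \<sigma> \<and> 2 \<le> length \<sigma> \<or> \<sigma> = [2, 4, 1, 3] \<or> \<sigma> = [3, 1, 4, 2]"
    by (rule two_generators_iff[OF p])
  then show "card (generators (interval_poset \<sigma>)) = 2 \<longleftrightarrow>
      separable (inverse_word \<sigma>) \<and> 2 \<le> length (inverse_word \<sigma>) \<or>
      inverse_word \<sigma> = [2, 4, 1, 3] \<or> inverse_word \<sigma> = [3, 1, 4, 2]"
    using separable_inverse_word[OF p] inverse_word_patterns[OF p] by simp
qed (simp_all add: num_two_generator_posets_eq little_schroeder_values)

end
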